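(* Let $\mathcal A=(A,\le_A)$ and $\mathcal B=(B,\le_B)$ be two finite nonempty posets with $A\cap B=\emptyset$. Let $\mathbf u\in\mathbb P_{\{1,2\}}$ be the two-element antichain on $\{1,2\}$, let $\mathbf c\in\mathbb P_{\{1,2\}}$ be the chain $1<2$, and let $\mathbf c'\in\mathbb P_{\{1,2\}}$ be the chain $2<1$. In $F_{\mathbb P}(1)$: 1. $\mathbf u\circ(\lfloor\mathcal A\rfloor,\lfloor\mathcal B\rfloor)=\mathbf u\bullet(\lfloor\mathcal A\rfloor,\lfloor\mathcal B\rfloor)=\mathbf u\blacktriangle(\lfloor\mathcal A\rfloor,\lfloor\mathcal B\rfloor)=\mathbf u\blacktriangledown(\lfloor\mathcal A\rfloor,\lfloor\mathcal B\rfloor)=\lfloor\mathcal A\mathcal B\rfloor$, where $\mathcal A\mathcal B=(A\sqcup B,\le)$ with $x\le y$ iff ($x,y\in A$ and $x\le_Ay$) or ($x,y\in B$ and $x\le_By$). The resulting bilinear product $m$ on $F_{\mathbb P}(1)$ is associative and commutative. 2. $\mathbf c\bullet(\lfloor\mathcal A\rfloor,\lfloor\mathcal B\rfloor)=\lfloor\mathcal A\downarrow\mathcal B\rfloor$, where $\mathcal A\downarrow\mathcal B=(A\sqcup B,\le)$ with $x\le y$ iff ($x,y\in A$ and $x\le_Ay$) or ($x,y\in B$ and $x\le_By$) or ($x\in A$ and $y\in B$). The resulting product $\downarrow$ is associative. 3. $(\mathbf u+\mathbf c)\circ(\lfloor\mathcal A\rfloor,\lfloor\mathcal B\rfloor)$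 is the sum of the isoclasses of all posets $\mathcal C=(A\sqcup B,\le_{\mathcal C})$ such that: for $x,y\in A$, $x\le_{\mathcal C}y$ iff $x\le_Ay$; for $x,y\in B$, $x\le_{\mathcal C}y$ iff $x\le_By$; and $A<B$, i.e. for all $x\in A$, $y\in B$, $x\not\ge_{\mathcal C}y$. The resulting product, denoted $*$, is associative. 4. $\mathbf c\blacktriangle(\lfloor\mathcal A\rfloor,\lfloor\mathcal B\rfloor)=\lfloor\mathcal A\triangle\mathcal B\rfloor$, where $\mathcal A\triangle\mathcal B=(A\sqcup B,\le)$ with $x\le y$ iff ($x,y\in A$ and $x\le_Ay$) or ($x,y\in B$ and $x\le_By$) or ($x\in A$ and $y\in\max(\mathcal B)$). The resulting product $\triangle$ is non associative permutative: for all $x,y,z\in F_{\mathbb P}(1)$, $x\triangle(y\triangle z)=(xy)\triangle z=y\triangle(x\triangle z)$, where $xy=m(x,y)$. 5. $\mathbf c'\blacktriangledown(\lfloor\mathcal A\rfloor,\lfloor\mathcal B\rfloor)=\lfloor\mathcal A\triangledown\mathcal B\rfloor$, where $\mathcal A\triangledown\mathcal B=(A\sqcup B,\le)$ with $x\le y$ iff ($x,y\in A$ and $x\le_Ay$) or ($x,y\in B$ and $x\le_By$) or ($x\in\min(\mathcal B)$ and $y\in A$). The resulting product $\triangledown$ is non associative permutative: for all $x,y,z\in F_{\mathbb P}(1)$, $x\triangledown(y\triangledown z)=(xy)\triangledown z=y\triangledown(x\triangledown z)$.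
   Context: $\mathbb P_A$ is the vector space (over a field) freely generated by all partial orders on the finite nonempty set $A$. $\lfloor\mathcal A\rfloor$ denotes the isomorphism class (isoclass) of a poset $\mathcal A$. $F_{\mathbb P}(1)=\bigoplus_{n\ge1}\mathbb P_{\{1,\dots,n\}}/\mathfrak S_n$ is identified with the vector space with basis the isoclasses of finite nonempty posets. $\min(\mathcal B)$, $\max(\mathcal B)$ are the sets of minimal, maximal elements. Partial compositions: for posets $\mathcal A,\mathcal B$ on disjoint sets and $a\in A$, put $A\sqcup_aB=(A\setminus\{a\})\sqcup B$. Each of $\mathcal A\bullet_a\mathcal B$, $\mathcal A\blacktriangle_a\mathcal B$, $\mathcal A\blacktriangledown_a\mathcal B$ is $A\sqcup_aB$ with a partial order restricting to $\le_B$ on $B$ and to $\le_A$ on $A\setminus\{a\}$, and for $x\in A\setminus\{a\}$, $y\in B$: in $\bullet_a$, $x\le y$ iff $x\le_Aa$, and $y\le x$ iff $a\le_Ax$; in $\blacktriangle_a$, $x\le y$ iff $x\le_Aa$ and $y\in\max(\mathcal B)$, and $y\le x$ iff $a\le_Ax$; in $\blacktriangledown_a$, $x\le y$ iff $x\le_Aa$, and $y\le x$ iff $a\le_Ax$ and $y\in\min(\mathcal B)$. $\mathcal A\circ_a\mathcal B$ is the sum of all posets $(A\sqcup_aB,\le)$ such that $\le$ restricts to $\le_B$ on $B$, $B$ is convex in $(A\sqcup_aB,\le)$ ($x,y\in B$, $x\le z\le y$ imply $z\in B$), and the quotient poset $(A\sqcup_aB,\le)/B$ equals $\mathcal A$ when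 the point $\{B\}$ is identified with $a$. Here, for a nonempty convex subset $B$ of $(P,\le)$, $(P,\le)/B$ is $(P\setminus B)\sqcup\{B\}$ with: $\{B\}\leqslant\{B\}$; $\{B\}\leqslant y$ iff $b\le y$ for some $b\in B$; $x\leqslant\{B\}$ iff $x\le b$ for some $b\in B$; and for $x,y\in P\setminus B$, $x\leqslant y$ iff $x\le y$ or there are $b,b'\in B$ with $x\le b$, $b'\le y$. For $\star\in\{\circ,\bullet,\blacktriangle,\blacktriangledown\}$ and $\mathcal D\in\mathbb P_{\{1,2\}}$: $\mathcal D\star(\mathcal A,\mathcal B):=(\mathcal D\star_1\mathcal A)\star_2\mathcal B=(\mathcal D\star_2\mathcal B)\star_1\mathcal A$ (linear in $\mathcal D$), and $\mathcal D\star(\lfloor\mathcal A\rfloor,\lfloor\mathcal B\rfloor)$ is its class in $F_{\mathbb P}(1)$, extended bilinearly. *)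

theory Defs
  imports Main "HOL-Library.Poly_Mapping"
begin

section \<open>Finite posets and their isomorphism classes\<close>

text \<open>A poset is represented by its order relation; since orders are reflexive, its ground set is
  the \<^const>\<open>Field\<close> of that relation.\<close>

definition finposet :: "'a rel \<Rightarrow> bool" where
  "finposet r \<longleftrightarrow> finite (Field r) \<and> Field r \<noteq> {} \<and> Partial_order r"

definition poset_iso :: "'a rel \<Rightarrow> 'b rel \<Rightarrow> bool" where
  "poset_iso r s \<longleftrightarrow> (\<exists>f. bij_betw f (Field r) (Field s) \<and>
     (\<forall>x\<in>Field r. \<forall>y\<in>Field r. (x, y) \<in> r \<longleftrightarrow> (f x, f y) \<in> s))"

definition minimals :: "'a rel \<Rightarrow> 'a set" where
  "minimals r = {y \<in> Field r. \<forall>x. (x, y) \<in> r \<longrightarrow> x = y}"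

definition maximals :: "'a rel \<Rightarrow> 'a set" where
  "maximals r = {x \<in> Field r. \<forall>y. (x, y) \<in> r \<longrightarrow> y = x}"

lemma finposet_singleton: "finposet {(a, a)}"
  by (simp add: finposet_def order_on_defs refl_on_def trans_def antisym_def Field_def)

lemma poset_iso_refl: "poset_iso r r"
  unfolding poset_iso_def by (rule exI[of _ id]) auto

lemma poset_iso_sym:
  assumes "poset_iso r s" shows "poset_iso s r"
proof -
  obtain f where f: "bij_betw f (Field r) (Field s)"
    "\<And>x y. x \<in> Field r \<Longrightarrow> y \<in> Field r \<Longrightarrow> (x, y) \<in> r \<longleftrightarrow> (f x, f y) \<in> s"
    using assms unfolding poset_iso_def by blast
  let ?g = "inv_into (Field r) f"
  have g: "bij_betw ?g (Field s) (Field r)" using f(1) by (rule bij_betw_inv_into)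
  have "(x, y) \<in> s \<longleftrightarrow> (?g x, ?g y) \<in> r" if "x \<in> Field s" "y \<in> Field s" for x y
    using that f(2)[of "?g x" "?g y"] bij_betw_inv_into_right[OF f(1)] bij_betwE[OF g] by simp
  with g show ?thesis unfolding poset_iso_def by blast
qed

lemma poset_iso_trans:
  assumes "poset_iso r s" "poset_iso s t" shows "poset_iso r t"
proof -
  obtain f where f: "bij_betw f (Field r) (Field s)"
    "\<And>x y. x \<in> Field r \<Longrightarrow> y \<in> Field r \<Longrightarrow> (x, y) \<in> r \<longleftrightarrow> (f x, f y) \<in> s"
    using assms(1) unfolding poset_iso_def by blast
  obtain g where g: "bij_betw g (Field s) (Field t)"
    "\<And>x y. x \<in> Field s \<Longrightarrow> y \<in> Field s \<Longrightarrow> (x, y) \<in> s \<longleftrightarrow> (g x, g y) \<in> t"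
    using assms(2) unfolding poset_iso_def by blast
  have "bij_betw (g \<circ> f) (Field r) (Field t)" using f(1) g(1) by (rule bij_betw_trans)
  moreover have "\<forall>x\<in>Field r. \<forall>y\<in>Field r. (x, y) \<in> r \<longleftrightarrow> ((g \<circ> f) x, (g \<circ> f) y) \<in> t"
    using f(2) g(2) bij_betwE[OF f(1)] by simp
  ultimately show ?thesis unfolding poset_iso_def by blast
qed

lemma poset_iso_cong: "poset_iso r s \<Longrightarrow> poset_iso r t \<longleftrightarrow> poset_iso s t"
  using poset_iso_trans[of r s t] poset_iso_trans[of s r t] poset_iso_sym[of r s] by blast

text \<open>Every finite poset is isomorphic to one whose elements are natural numbers, so the isoclasses
  of all finite nonempty posets are indexed by those of posets on finite subsets of \<open>nat\<close>.\<close>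

typedef isoclass =
  "Collect finposet // {(r, s :: nat rel). finposet r \<and> finposet s \<and> poset_iso r s}"
  using finposet_singleton[of "0::nat"] by (auto simp: quotient_def)

definition isoclass_of :: "'a rel \<Rightarrow> isoclass" where
  "isoclass_of r = Abs_isoclass {s. finposet s \<and> poset_iso r s}"

section \<open>Free vector spaces\<close>

text \<open>\<open>'b \<Rightarrow>\<^sub>0 'k\<close> is the vector space over \<open>'k\<close> with basis \<open>'b\<close>. For a finite set \<open>A\<close>, the space
  spanned by the partial orders on \<open>A\<close> consists of the elements of \<open>'a rel \<Rightarrow>\<^sub>0 'k\<close> supported on
  partial orders with field \<open>A\<close>; the space of isoclasses is \<open>isoclass \<Rightarrow>\<^sub>0 'k\<close>.\<close>

definition scale :: "'k::field \<Rightarrow> ('b \<Rightarrow>\<^sub>0 'k) \<Rightarrow> 'b \<Rightarrow>\<^sub>0 'k" where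
  "scale c x = Poly_Mapping.map ((*) c) x"

definition basis :: "'b \<Rightarrow> 'b \<Rightarrow>\<^sub>0 'k::field" where
  "basis b = Poly_Mapping.single b 1"

definition lin_ext :: "('b \<Rightarrow> 'c \<Rightarrow>\<^sub>0 'k) \<Rightarrow> ('b \<Rightarrow>\<^sub>0 'k::field) \<Rightarrow> 'c \<Rightarrow>\<^sub>0 'k" where
  "lin_ext f x = (\<Sum>b\<in>Poly_Mapping.keys x. scale (Poly_Mapping.lookup x b) (f b))"

definition cls :: "'a rel \<Rightarrow> isoclass \<Rightarrow>\<^sub>0 'k::field" where
  "cls r = basis (isoclass_of r)"

section \<open>Partial compositions\<close>

definition bullet :: "'a rel \<Rightarrow> 'a \<Rightarrow> 'a rel \<Rightarrow> 'a rel" where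
  "bullet r a s = Restr r (Field r - {a}) \<union> s
     \<union> {(x, y). x \<in> Field r - {a} \<and> y \<in> Field s \<and> (x, a) \<in> r}
     \<union> {(y, x). x \<in> Field r - {a} \<and> y \<in> Field s \<and> (a, x) \<in> r}"

definition btriangle :: "'a rel \<Rightarrow> 'a \<Rightarrow> 'a rel \<Rightarrow> 'a rel" where
  "btriangle r a s = Restr r (Field r - {a}) \<union> s
     \<union> {(x, y). x \<in> Field r - {a} \<and> y \<in> Field s \<and> (x, a) \<in> r \<and> y \<in> maximals s}
     \<union> {(y, x). x \<in> Field r - {a} \<and> y \<in> Field s \<and> (a, x) \<in> r}"

definition btriangledown :: "'a rel \<Rightarrow> 'a \<Rightarrow> 'a rel \<Rightarrow> 'a rel" where
  "btriangledown r a s = Restr r (Field r - {a}) \<union> s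
     \<union> {(x, y). x \<in> Field r - {a} \<and> y \<in> Field s \<and> (x, a) \<in> r}
     \<union> {(y, x). x \<in> Field r - {a} \<and> y \<in> Field s \<and> (a, x) \<in> r \<and> y \<in> minimals s}"

definition convex_in :: "'a rel \<Rightarrow> 'a set \<Rightarrow> bool" where
  "convex_in t S \<longleftrightarrow> S \<subseteq> Field t \<and>
     (\<forall>x\<in>S. \<forall>y\<in>S. \<forall>z. (x, z) \<in> t \<and> (z, y) \<in> t \<longrightarrow> z \<in> S)"

text \<open>The quotient poset in which the convex subset \<open>S\<close> is contracted to a single point; that point
  is directly given the name \<open>a\<close> instead of \<open>{S}\<close>.\<close>

definition contract :: "'a rel \<Rightarrow> 'a set \<Rightarrow> 'a \<Rightarrow> 'a rel" where
  "contract t S a = {(a, a)}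
     \<union> {(a, y) | y. y \<in> Field t - S \<and> (\<exists>b\<in>S. (b, y) \<in> t)}
     \<union> {(x, a) | x. x \<in> Field t - S \<and> (\<exists>b\<in>S. (x, b) \<in> t)}
     \<union> {(x, y). x \<in> Field t - S \<and> y \<in> Field t - S \<and>
          ((x, y) \<in> t \<or> (\<exists>b\<in>S. \<exists>b'\<in>S. (x, b) \<in> t \<and> (b', y) \<in> t))}"

definition circ_posets :: "'a rel \<Rightarrow> 'a \<Rightarrow> 'a rel \<Rightarrow> 'a rel set" where
  "circ_posets r a s = {t. Partial_order t \<and> Field t = (Field r - {a}) \<union> Field s \<and>
     Restr t (Field s) = s \<and> convex_in t (Field s) \<and> contract t (Field s) a = r}"

type_synonym ('a, 'k) pcomp = "'a rel \<Rightarrow> 'a \<Rightarrow> 'a rel \<Rightarrow> 'a rel \<Rightarrow>\<^sub>0 'k"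

definition Circ :: "('a, 'k::field) pcomp" where
  "Circ r a s = (\<Sum>t\<in>circ_posets r a s. basis t)"

definition Bullet :: "('a, 'k::field) pcomp" where
  "Bullet r a s = basis (bullet r a s)"

definition BTriangle :: "('a, 'k::field) pcomp" where
  "BTriangle r a s = basis (btriangle r a s)"

definition BTriangledown :: "('a, 'k::field) pcomp" where
  "BTriangledown r a s = basis (btriangledown r a s)"

section \<open>Products on the space of isoclasses\<close>

definition u_poset :: "nat rel" where "u_poset = {(1, 1), (2, 2)}"
definition c_poset :: "nat rel" where "c_poset = {(1, 1), (2, 2), (1, 2)}"
definition c'_poset :: "nat rel" where "c'_poset = {(1, 1), (2, 2), (2, 1)}"

text \<open>\<open>compose2 P D r s\<close> is \<open>(D \<star>\<^sub>1 r) \<star>\<^sub>2 s\<close>, where \<open>P\<close> is the partial composition \<open>\<star>\<close>. It is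
  meaningful if the fields of \<open>r\<close> and \<open>s\<close> are disjoint and do not contain the labels 1, 2 of \<open>D\<close>.\<close>

definition compose2 ::
    "(nat, 'k) pcomp \<Rightarrow> (nat rel \<Rightarrow>\<^sub>0 'k) \<Rightarrow> nat rel \<Rightarrow> nat rel \<Rightarrow> nat rel \<Rightarrow>\<^sub>0 'k::field" where
  "compose2 P D r s = lin_ext (\<lambda>t. P t 2 s) (lin_ext (\<lambda>d. P d 1 r) D)"

definition representatives :: "isoclass \<Rightarrow> isoclass \<Rightarrow> nat rel \<times> nat rel \<Rightarrow> bool" where
  "representatives \<alpha> \<beta> = (\<lambda>(r, s). r \<in> Rep_isoclass \<alpha> \<and> s \<in> Rep_isoclass \<beta> \<and>
     Field r \<inter> Field s = {} \<and> Field r \<inter> {1, 2} = {} \<and> Field s \<inter> {1, 2} = {})"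

text \<open>The value of \<open>D \<star> (\<alpha>, \<beta>)\<close> does not depend on the representatives chosen; see
  \<open>class_compose_eq\<close> below.\<close>

definition class_compose ::
    "(nat, 'k) pcomp \<Rightarrow> (nat rel \<Rightarrow>\<^sub>0 'k) \<Rightarrow> isoclass \<Rightarrow> isoclass \<Rightarrow> isoclass \<Rightarrow>\<^sub>0 'k::field" where
  "class_compose P D \<alpha> \<beta> =
     (case (SOME rs. representatives \<alpha> \<beta> rs) of (r, s) \<Rightarrow> lin_ext cls (compose2 P D r s))"

definition bilin ::
    "(nat, 'k) pcomp \<Rightarrow> (nat rel \<Rightarrow>\<^sub>0 'k) \<Rightarrow>
     (isoclass \<Rightarrow>\<^sub>0 'k) \<Rightarrow> (isoclass \<Rightarrow>\<^sub>0 'k) \<Rightarrow> isoclass \<Rightarrow>\<^sub>0 'k::field" where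
  "bilin P D x y = lin_ext (\<lambda>\<alpha>. lin_ext (\<lambda>\<beta>. class_compose P D \<alpha> \<beta>) y) x"

definition prod_m :: "(isoclass \<Rightarrow>\<^sub>0 'k) \<Rightarrow> (isoclass \<Rightarrow>\<^sub>0 'k) \<Rightarrow> isoclass \<Rightarrow>\<^sub>0 'k::field" where
  "prod_m = bilin Circ (basis u_poset)"

definition prod_down :: "(isoclass \<Rightarrow>\<^sub>0 'k) \<Rightarrow> (isoclass \<Rightarrow>\<^sub>0 'k) \<Rightarrow> isoclass \<Rightarrow>\<^sub>0 'k::field" where
  "prod_down = bilin Bullet (basis c_poset)"

definition prod_star :: "(isoclass \<Rightarrow>\<^sub>0 'k) \<Rightarrow> (isoclass \<Rightarrow>\<^sub>0 'k) \<Rightarrow> isoclass \<Rightarrow>\<^sub>0 'k::field" where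
  "prod_star = bilin Circ (basis u_poset + basis c_poset)"

definition prod_tri :: "(isoclass \<Rightarrow>\<^sub>0 'k) \<Rightarrow> (isoclass \<Rightarrow>\<^sub>0 'k) \<Rightarrow> isoclass \<Rightarrow>\<^sub>0 'k::field" where
  "prod_tri = bilin BTriangle (basis c_poset)"

definition prod_tridown :: "(isoclass \<Rightarrow>\<^sub>0 'k) \<Rightarrow> (isoclass \<Rightarrow>\<^sub>0 'k) \<Rightarrow> isoclass \<Rightarrow>\<^sub>0 'k::field" where
  "prod_tridown = bilin BTriangledown (basis c'_poset)"

section \<open>Posets on a disjoint union\<close>

definition poset_union :: "'a rel \<Rightarrow> 'a rel \<Rightarrow> 'a rel" where
  "poset_union r s = r \<union> s"

definition poset_down :: "'a rel \<Rightarrow> 'a rel \<Rightarrow> 'a rel" where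
  "poset_down r s = r \<union> s \<union> Field r \<times> Field s"

definition poset_tri :: "'a rel \<Rightarrow> 'a rel \<Rightarrow> 'a rel" where
  "poset_tri r s = r \<union> s \<union> Field r \<times> maximals s"

definition poset_tridown :: "'a rel \<Rightarrow> 'a rel \<Rightarrow> 'a rel" where
  "poset_tridown r s = r \<union> s \<union> minimals s \<times> Field r"

definition star_posets :: "'a rel \<Rightarrow> 'a rel \<Rightarrow> 'a rel set" where
  "star_posets r s = {t. Partial_order t \<and> Field t = Field r \<union> Field s \<and>
     (\<forall>x\<in>Field r. \<forall>y\<in>Field r. (x, y) \<in> t \<longleftrightarrow> (x, y) \<in> r) \<and>
     (\<forall>x\<in>Field s. \<forall>y\<in>Field s. (x, y) \<in> t \<longleftrightarrow> (x, y) \<in> s) \<and>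
     (\<forall>x\<in>Field r. \<forall>y\<in>Field s. (y, x) \<notin> t)}"

section \<open>Independence of representatives\<close>

lemma Field_map_prod: "Field (map_prod f f ` r) = f ` Field r"
  by (auto simp: Field_def Domain_iff Range_iff image_iff; blast)

lemma poset_iso_nat:
  fixes r :: "'a rel"
  assumes "finposet r"
  shows "\<exists>s :: nat rel. finposet s \<and> poset_iso r s"
proof -
  have fin: "finite (Field r)" and ne: "Field r \<noteq> {}" and po: "Partial_order r"
    using assms by (auto simp: finposet_def)
  obtain f :: "'a \<Rightarrow> nat" where inj: "inj_on f (Field r)"
    using finite_imp_inj_to_nat_seg[OF fin] by blast
  define s where "s = map_prod f f ` r"
  have Fs: "Field s = f ` Field r" unfolding s_def by (rule Field_map_prod)
  have iff: "(x, y) \<in> r \<longleftrightarrow> (f x, f y) \<in> s" if "x \<in> Field r" "y \<in> Field r" for x y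
  proof
    assume "(f x, f y) \<in> s"
    then obtain a b where ab: "(a, b) \<in> r" "f x = f a" "f y = f b" unfolding s_def by auto
    then have "a \<in> Field r" "b \<in> Field r" by (auto intro: FieldI1 FieldI2)
    then have "x = a" "y = b" using ab that inj by (simp_all add: inj_on_def)
    then show "(x, y) \<in> r" using ab by simp
  qed (force simp: s_def)
  have "Partial_order s"
    unfolding order_on_defs
  proof (intro conjI)
    show "s \<subseteq> Field s \<times> Field s" by (auto simp: Field_def)
    show "Refl s" using po iff unfolding order_on_defs refl_on_def Fs by auto
    have mem: "\<exists>a b. x = f a \<and> y = f b \<and> a \<in> Field r \<and> b \<in> Field r" if "(x, y) \<in> s" for x y
      using that unfolding s_def by (auto intro: FieldI1 FieldI2)
    show "trans s"
    proof (rule transI)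
      fix x y z assume 1: "(x, y) \<in> s" "(y, z) \<in> s"
      obtain a b where a: "x = f a" "y = f b" "a \<in> Field r" "b \<in> Field r" using mem[OF 1(1)] by blast
      obtain c where c: "z = f c" "c \<in> Field r" using mem[OF 1(2)] by blast
      have "(a, b) \<in> r" "(b, c) \<in> r" using 1 a c iff by auto
      then have "(a, c) \<in> r" using po unfolding order_on_defs by (blast dest: transD)
      then show "(x, z) \<in> s" using a c iff by auto
    qed
    show "antisym s"
    proof (rule antisymI)
      fix x y assume 1: "(x, y) \<in> s" "(y, x) \<in> s"
      obtain a b where a: "x = f a" "y = f b" "a \<in> Field r" "b \<in> Field r" using mem[OF 1(1)] by blast
      have "(a, b) \<in> r" "(b, a) \<in> r" using 1 a iff by auto
      then show "x = y" using a po unfolding order_on_defs by (blast dest: antisymD)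
    qed
  qed
  moreover have "poset_iso r s"
    unfolding poset_iso_def using inj iff by (intro exI[of _ f]) (auto simp: bij_betw_def Fs)
  moreover have "finite (Field s)" "Field s \<noteq> {}" using fin ne by (simp_all add: Fs)
  ultimately show ?thesis unfolding finposet_def by blast
qed

lemma Rep_isoclass_of:
  assumes "finposet r"
  shows "Rep_isoclass (isoclass_of r) = {s. finposet s \<and> poset_iso r s}"
proof -
  obtain t :: "nat rel" where t: "finposet t" "poset_iso r t" using poset_iso_nat[OF assms] by blast
  then have "{s. finposet s \<and> poset_iso r s}
      = {(r, s :: nat rel). finposet r \<and> finposet s \<and> poset_iso r s} `` {t}"
    by (auto simp: poset_iso_cong[OF t(2)])
  then have "{s. finposet s \<and> poset_iso r s}
      \<in> Collect finposet // {(r, s :: nat rel). finposet r \<and> finposet s \<and> poset_iso r s}"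
    by (simp only:) (rule quotientI, simp add: t(1))
  then show ?thesis unfolding isoclass_of_def by (rule Abs_isoclass_inverse)
qed

lemma isoclass_of_eqI:
  assumes "poset_iso r s" shows "isoclass_of r = isoclass_of s"
  unfolding isoclass_of_def by (simp add: poset_iso_cong[OF assms])

lemma isoclass_of_eq_iff:
  assumes "finposet r" "finposet s"
  shows "isoclass_of r = isoclass_of s \<longleftrightarrow> poset_iso r s"
proof
  assume eq: "isoclass_of r = isoclass_of s"
  obtain t :: "nat rel" where t: "finposet t" "poset_iso r t" using poset_iso_nat[OF assms(1)] by blast
  then have "t \<in> Rep_isoclass (isoclass_of s)"
    using Rep_isoclass_of[OF assms(1)] eq by auto
  then have "poset_iso s t" using Rep_isoclass_of[OF assms(2)] by auto
  then show "poset_iso r s" by (rule poset_iso_trans[OF t(2) poset_iso_sym])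
qed (rule isoclass_of_eqI)

lemma lookup_scale: "Poly_Mapping.lookup (scale c x) b = c * Poly_Mapping.lookup x b"
  unfolding scale_def by (simp add: Poly_Mapping.map.rep_eq when_def)

lemma scale_add: "scale c (x + y) = scale c x + scale c y"
  by (rule poly_mapping_eqI) (simp add: lookup_scale lookup_add algebra_simps)

lemma scale_add_left: "scale (c + d) x = scale c x + scale d x"
  by (rule poly_mapping_eqI) (simp add: lookup_scale lookup_add algebra_simps)

lemma scale_scale: "scale c (scale d x) = scale (c * d) x"
  by (rule poly_mapping_eqI) (simp add: lookup_scale algebra_simps)

lemma scale_0 [simp]: "scale 0 x = 0" "scale c 0 = 0"
  by (rule poly_mapping_eqI, simp add: lookup_scale)+

lemma scale_1 [simp]: "scale 1 x = x"
  by (rule poly_mapping_eqI) (simp add: lookup_scale)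

lemma scale_sum: "scale c (sum f S) = (\<Sum>i\<in>S. scale c (f i))"
  by (induction S rule: infinite_finite_induct) (auto simp: scale_add)

lemma lin_ext_superset:
  assumes "finite S" "Poly_Mapping.keys x \<subseteq> S"
  shows "lin_ext f x = (\<Sum>b\<in>S. scale (Poly_Mapping.lookup x b) (f b))"
  unfolding lin_ext_def using assms
  by (intro sum.mono_neutral_left) (auto simp: in_keys_iff)

lemma lin_ext_basis [simp]: "lin_ext f (basis b) = f b"
  unfolding lin_ext_def basis_def by simp

lemma lin_ext_0 [simp]: "lin_ext f 0 = 0"
  by (simp add: lin_ext_def)

lemma lin_ext_add: "lin_ext f (x + y) = lin_ext f x + lin_ext f y"
proof -
  let ?S = "Poly_Mapping.keys x \<union> Poly_Mapping.keys y"
  have "lin_ext f z = (\<Sum>b\<in>?S. scale (Poly_Mapping.lookup z b) (f b))"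
    if "z \<in> {x, y, x + y}" for z
    using that Poly_Mapping.keys_add[of x y] by (intro lin_ext_superset) auto
  then show ?thesis by (simp add: lookup_add scale_add_left sum.distrib)
qed

lemma lin_ext_scale: "lin_ext f (scale c x) = scale c (lin_ext f x)"
proof -
  have "Poly_Mapping.keys (scale c x) \<subseteq> Poly_Mapping.keys x"
    by (auto simp: in_keys_iff lookup_scale)
  then have "lin_ext f (scale c x)
      = (\<Sum>b\<in>Poly_Mapping.keys x. scale (Poly_Mapping.lookup (scale c x) b) (f b))"
    by (intro lin_ext_superset) auto
  then show ?thesis by (simp add: lookup_scale lin_ext_def scale_sum scale_scale)
qed

lemma lin_ext_sum: "lin_ext f (sum g S) = (\<Sum>i\<in>S. lin_ext f (g i))"
  by (induction S rule: infinite_finite_induct) (auto simp: lin_ext_add)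

lemma lin_ext_lin_ext: "lin_ext f (lin_ext g x) = lin_ext (\<lambda>b. lin_ext f (g b)) x"
  unfolding lin_ext_def[of g] by (simp add: lin_ext_sum lin_ext_scale lin_ext_def[of _ x])

lemma lin_ext_cong: "(\<And>b. b \<in> Poly_Mapping.keys x \<Longrightarrow> f b = g b) \<Longrightarrow> lin_ext f x = lin_ext g x"
  unfolding lin_ext_def by (intro sum.cong) auto

definition relabel :: "('a \<Rightarrow> 'b) \<Rightarrow> 'a rel \<Rightarrow> 'b rel" where
  "relabel h r = map_prod h h ` r"

definition relabel_vec :: "('a \<Rightarrow> 'b) \<Rightarrow> ('a rel \<Rightarrow>\<^sub>0 'k) \<Rightarrow> 'b rel \<Rightarrow>\<^sub>0 'k::field" where
  "relabel_vec h = lin_ext (\<lambda>r. basis (relabel h r))"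

lemma Field_relabel [simp]: "Field (relabel h r) = h ` Field r"
  unfolding relabel_def by (rule Field_map_prod)

lemma relabel_mem: "inj h \<Longrightarrow> (h x, h y) \<in> relabel h r \<longleftrightarrow> (x, y) \<in> r"
  unfolding relabel_def by (auto dest: injD)

lemma relabel_eq_iff:
  assumes "bij h"
  shows "t = relabel h r \<longleftrightarrow> (\<forall>x y. (h x, h y) \<in> t \<longleftrightarrow> (x, y) \<in> r)"
proof
  assume *: "\<forall>x y. (h x, h y) \<in> t \<longleftrightarrow> (x, y) \<in> r"
  have "(u, v) \<in> t \<longleftrightarrow> (u, v) \<in> relabel h r" for u v
    using * relabel_mem[OF bij_is_inj[OF assms]] bij_pointE[OF assms] by metis
  then show "t = relabel h r" by auto
qed (simp add: relabel_mem[OF bij_is_inj[OF assms]])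

lemma relabel_inject: "inj h \<Longrightarrow> relabel h r = relabel h s \<longleftrightarrow> r = s"
  unfolding relabel_def by (simp add: inj_image_eq_iff prod.inj_map)

lemma ex_relabel: "bij h \<Longrightarrow> \<exists>s. t = relabel h s"
  by (rule exI[of _ "{(x, y). (h x, h y) \<in> t}"]) (simp add: relabel_eq_iff)

lemma poset_iso_relabel: "inj h \<Longrightarrow> poset_iso r (relabel h r)"
  unfolding poset_iso_def
  by (rule exI[of _ h]) (auto simp: relabel_mem bij_betw_def inj_on_def)

lemma bij_all_iff: "bij h \<Longrightarrow> (\<forall>x. P x) \<longleftrightarrow> (\<forall>x. P (h x))"
  by (metis bij_pointE)

lemma maximals_relabel: "bij h \<Longrightarrow> h x \<in> maximals (relabel h r) \<longleftrightarrow> x \<in> maximals r"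
  unfolding maximals_def
  by (simp add: relabel_mem bij_is_inj inj_image_mem_iff bij_all_iff[of h "\<lambda>y. (h x, y) \<in> relabel h r \<longrightarrow> y = h x"] inj_eq)

lemma minimals_relabel: "bij h \<Longrightarrow> h x \<in> minimals (relabel h r) \<longleftrightarrow> x \<in> minimals r"
  unfolding minimals_def
  by (simp add: relabel_mem bij_is_inj inj_image_mem_iff bij_all_iff[of h "\<lambda>y. (y, h x) \<in> relabel h r \<longrightarrow> y = h x"] inj_eq)

lemmas relabel_simps = relabel_mem bij_is_inj inj_image_mem_iff inj_eq
  maximals_relabel minimals_relabel

lemma bullet_relabel:
  "bij h \<Longrightarrow> bullet (relabel h r) (h a) (relabel h s) = relabel h (bullet r a s)"
  by (subst relabel_eq_iff) (auto simp: bullet_def relabel_simps)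

lemma btriangle_relabel:
  "bij h \<Longrightarrow> btriangle (relabel h r) (h a) (relabel h s) = relabel h (btriangle r a s)"
  by (subst relabel_eq_iff) (auto simp: btriangle_def relabel_simps)

lemma btriangledown_relabel:
  "bij h \<Longrightarrow> btriangledown (relabel h r) (h a) (relabel h s) = relabel h (btriangledown r a s)"
  by (subst relabel_eq_iff) (auto simp: btriangledown_def relabel_simps)

lemma contract_relabel:
  "bij h \<Longrightarrow> contract (relabel h t) (h ` S) (h a) = relabel h (contract t S a)"
  by (subst relabel_eq_iff) (auto simp: contract_def relabel_simps)

lemma convex_in_relabel:
  "bij h \<Longrightarrow> convex_in (relabel h t) (h ` S) \<longleftrightarrow> convex_in t S"
  unfolding convex_in_def
  by (simp add: relabel_simps inj_image_subset_iff
      bij_all_iff[of h "\<lambda>z. (h _, z) \<in> relabel h t \<and> (z, h _) \<in> relabel h t \<longrightarrow> z \<in> h ` S"])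

lemma Restr_relabel: "bij h \<Longrightarrow> Restr (relabel h t) (h ` S) = relabel h (Restr t S)"
  by (subst relabel_eq_iff) (auto simp: relabel_simps)

lemma Partial_order_relabel:
  assumes "bij h" shows "Partial_order (relabel h t) \<longleftrightarrow> Partial_order t"
proof -
  have inj: "inj h" using assms by (rule bij_is_inj)
  have mem: "\<exists>a b. x = h a \<and> y = h b \<and> (a, b) \<in> t" if "(x, y) \<in> relabel h t" for x y
    using that unfolding relabel_def by auto
  have "trans (relabel h t) \<longleftrightarrow> trans t"
  proof
    assume tr: "trans (relabel h t)"
    show "trans t"
    proof (rule transI)
      fix x y z assume "(x, y) \<in> t" "(y, z) \<in> t"
      then have "(h x, h z) \<in> relabel h t" using transD[OF tr, of "h x" "h y" "h z"]
        by (simp add: relabel_mem[OF inj])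
      then show "(x, z) \<in> t" by (simp add: relabel_mem[OF inj])
    qed
  next
    assume tr: "trans t"
    show "trans (relabel h t)"
    proof (rule transI)
      fix x y z assume 1: "(x, y) \<in> relabel h t" "(y, z) \<in> relabel h t"
      obtain a b where a: "x = h a" "y = h b" "(a, b) \<in> t" using mem[OF 1(1)] by blast
      obtain b' c where c: "y = h b'" "z = h c" "(b', c) \<in> t" using mem[OF 1(2)] by blast
      have "b' = b" using a c injD[OF inj] by simp
      then have "(a, c) \<in> t" using a c transD[OF tr] by blast
      then show "(x, z) \<in> relabel h t" using a c by (simp add: relabel_mem[OF inj])
    qed
  qed
  moreover have "antisym (relabel h t) \<longleftrightarrow> antisym t"
  proof
    assume an: "antisym (relabel h t)"
    show "antisym t"
    proof (rule antisymI)
      fix x y assume "(x, y) \<in> t" "(y, x) \<in> t"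
      then have "h x = h y" using antisymD[OF an, of "h x" "h y"]
        by (simp add: relabel_mem[OF inj])
      then show "x = y" by (rule injD[OF inj])
    qed
  next
    assume an: "antisym t"
    show "antisym (relabel h t)"
    proof (rule antisymI)
      fix x y assume 1: "(x, y) \<in> relabel h t" "(y, x) \<in> relabel h t"
      obtain a b where a: "x = h a" "y = h b" "(a, b) \<in> t" using mem[OF 1(1)] by blast
      then have "(b, a) \<in> t" using 1(2) by (simp add: relabel_mem[OF inj])
      then show "x = y" using a antisymD[OF an] by blast
    qed
  qed
  moreover have "Refl (relabel h t) \<longleftrightarrow> Refl t"
    unfolding refl_on_def by (simp add: relabel_mem[OF inj])
  moreover have "relabel h t \<subseteq> Field (relabel h t) \<times> Field (relabel h t)" "t \<subseteq> Field t \<times> Field t"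
    by (auto simp del: Field_relabel intro: FieldI1 FieldI2)
  ultimately show ?thesis unfolding order_on_defs by simp
qed

lemma circ_posets_relabel:
  assumes "bij h"
  shows "circ_posets (relabel h r) (h a) (relabel h s) = relabel h ` circ_posets r a s"
proof -
  have inj: "inj h" using assms by (rule bij_is_inj)
  have set: "h ` Field r - {h a} \<union> h ` Field s = h ` (Field r - {a} \<union> Field s)"
    using inj by (auto dest: injD)
  have "relabel h t \<in> circ_posets (relabel h r) (h a) (relabel h s) \<longleftrightarrow> t \<in> circ_posets r a s" for t
    unfolding circ_posets_def
    by (simp add: Partial_order_relabel[unfolded Field_relabel] assms set inj_image_eq_iff inj Restr_relabel
        relabel_inject convex_in_relabel contract_relabel)
  then show ?thesis
    using ex_relabel[OF assms] by (intro set_eqI) (metis image_iff)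
qed

definition equivariant :: "('a, 'k::field) pcomp \<Rightarrow> bool" where
  "equivariant P \<longleftrightarrow> (\<forall>h r a s. bij h \<longrightarrow>
     P (relabel h r) (h a) (relabel h s) = relabel_vec h (P r a s))"

lemma equivariant_pcomps:
  "equivariant Circ" "equivariant Bullet" "equivariant BTriangle" "equivariant BTriangledown"
proof -
  have "inj_on (relabel h) S" if "bij h" for h :: "'a \<Rightarrow> 'a" and S
    using that by (intro inj_onI) (simp only: relabel_inject bij_is_inj)
  then show "equivariant (Circ :: ('a, 'k::field) pcomp)"
    unfolding equivariant_def Circ_def relabel_vec_def
    by (simp add: circ_posets_relabel lin_ext_sum sum.reindex)
qed (simp_all add: equivariant_def Bullet_def BTriangle_def BTriangledown_def relabel_vec_def
      bullet_relabel btriangle_relabel btriangledown_relabel)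

lemma compose2_relabel:
  assumes P: "equivariant P" and h: "bij h" "h 1 = 1" "h 2 = 2"
    and D: "\<And>d. d \<in> Poly_Mapping.keys D \<Longrightarrow> Field d = {1, 2}"
  shows "lin_ext cls (compose2 P D (relabel h r) (relabel h s)) = lin_ext cls (compose2 P D r s)"
proof -
  have fixd: "relabel h d = d" if d: "d \<in> Poly_Mapping.keys D" for d
  proof -
    have "map_prod h h p = p" if p: "p \<in> d" for p
    proof -
      obtain a b where ab: "p = (a, b)" by (cases p)
      then have "a \<in> {1, 2}" "b \<in> {1, 2}"
        using p D[OF d] FieldI1[of a b d] FieldI2[of a b d] by simp_all
      then show ?thesis using ab h(2,3) by auto
    qed
    then show ?thesis unfolding relabel_def by simp
  qed
  have 1: "lin_ext (\<lambda>d. P d 1 (relabel h r)) D = relabel_vec h (lin_ext (\<lambda>d. P d 1 r) D)"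
  proof -
    have "P d 1 (relabel h r) = relabel_vec h (P d 1 r)" if "d \<in> Poly_Mapping.keys D" for d
      using P h fixd[OF that] unfolding equivariant_def by metis
    then show ?thesis unfolding relabel_vec_def lin_ext_lin_ext by (intro lin_ext_cong)
  qed
  have "P (relabel h t) 2 (relabel h s) = relabel_vec h (P t 2 s)" for t
    using P h unfolding equivariant_def by metis
  then have "compose2 P D (relabel h r) (relabel h s) = relabel_vec h (compose2 P D r s)"
    unfolding compose2_def 1 by (simp add: relabel_vec_def lin_ext_lin_ext)
  moreover have "(cls (relabel h t) :: isoclass \<Rightarrow>\<^sub>0 'a) = cls t" for t
    unfolding cls_def using isoclass_of_eqI[OF poset_iso_relabel[OF bij_is_inj[OF h(1)], of t]] by simp
  ultimately show ?thesis by (simp add: relabel_vec_def lin_ext_lin_ext)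
qed

lemma extend_inj_on_to_bij:
  assumes "finite S" "inj_on f S"
  shows "\<exists>h :: 'a \<Rightarrow> 'a. bij h \<and> (\<forall>x\<in>S. h x = f x)"
proof -
  define U where "U = S \<union> f ` S"
  have fin: "finite U" using assms(1) by (simp add: U_def)
  have "card (U - S) = card (U - f ` S)"
    using assms fin by (simp add: U_def card_Diff_subset card_image)
  then obtain g where g: "bij_betw g (U - S) (U - f ` S)"
    using fin finite_same_card_bij[of "U - S" "U - f ` S"] by auto
  let ?h = "\<lambda>x. if x \<in> S then f x else if x \<in> U then g x else x"
  have "bij_betw ?h S (f ` S)" using assms(2) by (auto simp: bij_betw_def inj_on_def)
  moreover have "bij_betw ?h (U - S) (U - f ` S)"
    by (rule bij_betw_cong[THEN iffD1, OF _ g]) auto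
  ultimately have "bij_betw ?h (S \<union> (U - S)) (f ` S \<union> (U - f ` S))"
    by (rule bij_betw_combine) auto
  moreover have "S \<union> (U - S) = U" "f ` S \<union> (U - f ` S) = U" by (auto simp: U_def)
  ultimately have "bij_betw ?h U U" by simp
  moreover have "bij_betw ?h (- U) (- U)"
    by (auto simp: bij_betw_def inj_on_def U_def image_iff)
  ultimately have "bij_betw ?h (U \<union> - U) (U \<union> - U)" by (rule bij_betw_combine) auto
  then have "bij ?h" by simp
  then show ?thesis by (intro exI[of _ ?h]) auto
qed

lemma representatives_relabel:
  assumes "representatives \<alpha> \<beta> (r, s)" "representatives \<alpha> \<beta> (r', s')"
  shows "\<exists>h. bij h \<and> h 1 = 1 \<and> h 2 = 2 \<and> r' = relabel h r \<and> s' = relabel h s"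
proof -
  have iso: "finposet t \<and> finposet t' \<and> poset_iso t t'"
    if t: "t \<in> Rep_isoclass \<gamma>" "t' \<in> Rep_isoclass \<gamma>" for t t' \<gamma>
  proof -
    obtain q :: "nat rel" where q: "finposet q" "Rep_isoclass \<gamma>
        = {(r, s :: nat rel). finposet r \<and> finposet s \<and> poset_iso r s} `` {q}"
      using Rep_isoclass[of \<gamma>] by (elim quotientE) simp
    then have "finposet t" "finposet t'" "poset_iso q t" "poset_iso q t'" using t by auto
    then show ?thesis using poset_iso_cong[of q t t'] by blast
  qed
  have fin: "finite (Field r)" "finite (Field s)" and "poset_iso r r'" "poset_iso s s'"
    using assms iso by (auto simp: representatives_def finposet_def)
  then obtain f g where f: "bij_betw f (Field r) (Field r')"
      "\<And>x y. x \<in> Field r \<Longrightarrow> y \<in> Field r \<Longrightarrow> (x, y) \<in> r \<longleftrightarrow> (f x, f y) \<in> r'"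
    and g: "bij_betw g (Field s) (Field s')"
      "\<And>x y. x \<in> Field s \<Longrightarrow> y \<in> Field s \<Longrightarrow> (x, y) \<in> s \<longleftrightarrow> (g x, g y) \<in> s'"
    unfolding poset_iso_def by metis
  let ?k = "\<lambda>x. if x \<in> Field r then f x else if x \<in> Field s then g x else x"
  have dj: "Field r \<inter> Field s = {}" "Field r' \<inter> Field s' = {}"
      "Field r \<inter> {1, 2} = {}" "Field s \<inter> {1, 2} = {}" "Field r' \<inter> {1, 2} = {}" "Field s' \<inter> {1, 2} = {}"
    using assms by (auto simp: representatives_def)
  have "bij_betw ?k (Field r) (Field r')" using f(1) by (auto cong: bij_betw_cong)
  moreover have "bij_betw ?k (Field s) (Field s')"
    by (rule bij_betw_cong[THEN iffD1, OF _ g(1)]) (use dj in auto)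
  ultimately have "bij_betw ?k (Field r \<union> Field s) (Field r' \<union> Field s')"
    by (rule bij_betw_combine) (rule dj)
  moreover have "bij_betw ?k {1, 2} {1, 2}" using dj by (auto simp: bij_betw_def inj_on_def)
  ultimately have "bij_betw ?k (Field r \<union> Field s \<union> {1, 2}) (Field r' \<union> Field s' \<union> {1, 2})"
    by (rule bij_betw_combine) (use dj in auto)
  then have "inj_on ?k (Field r \<union> Field s \<union> {1, 2})" by (rule bij_betw_imp_inj_on)
  then obtain h where h: "bij h" "\<And>x. x \<in> Field r \<union> Field s \<union> {1, 2} \<Longrightarrow> h x = ?k x"
    using fin extend_inj_on_to_bij[of "Field r \<union> Field s \<union> {1, 2}" ?k] by auto
  have hr: "h x = f x" if "x \<in> Field r" for x using h(2) that by auto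
  have hs: "h x = g x" if "x \<in> Field s" for x using h(2)[of x] that dj by auto
  have transport: "t' = relabel h t"
    if k: "bij_betw k (Field t) (Field t')" "\<And>x. x \<in> Field t \<Longrightarrow> h x = k x"
      "\<And>x y. x \<in> Field t \<Longrightarrow> y \<in> Field t \<Longrightarrow> (x, y) \<in> t \<longleftrightarrow> (k x, k y) \<in> t'" for t t' k
  proof -
    have im: "h ` Field t = Field t'" using k(1,2) by (auto simp: bij_betw_def)
    have "(h x, h y) \<in> t' \<longleftrightarrow> (x, y) \<in> t" for x y
    proof (cases "x \<in> Field t \<and> y \<in> Field t")
      case False
      then have "h x \<notin> Field t' \<or> h y \<notin> Field t'"
        using im inj_image_mem_iff[OF bij_is_inj[OF h(1)]] by metis
      with False show ?thesis by (auto intro: FieldI1 FieldI2)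
    qed (use k in auto)
    then show ?thesis by (simp add: relabel_eq_iff h(1))
  qed
  have "h 1 = 1" "h 2 = 2" using h(2)[of 1] h(2)[of 2] dj by auto
  moreover have "r' = relabel h r" by (rule transport[OF f(1) hr f(2)])
  moreover have "s' = relabel h s" by (rule transport[OF g(1) hs g(2)])
  ultimately show ?thesis using h(1) by blast
qed

theorem class_compose_eq:
  assumes "equivariant P" and "\<And>d. d \<in> Poly_Mapping.keys D \<Longrightarrow> Field d = {1, 2}"
    and "finposet r" "finposet s"
    and "Field r \<inter> Field s = {}" "Field r \<inter> {1, 2} = {}" "Field s \<inter> {1, 2} = {}"
  shows "class_compose P D (isoclass_of r) (isoclass_of s) = lin_ext cls (compose2 P D r s)"
proof -
  let ?R = "representatives (isoclass_of r) (isoclass_of s)"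
  have rs: "?R (r, s)"
    using assms(3-) by (auto simp: representatives_def Rep_isoclass_of poset_iso_refl)
  obtain r' s' where eq: "(SOME rs. ?R rs) = (r', s')" by fastforce
  have "?R (r', s')" using someI[of ?R, OF rs] eq by simp
  then obtain h where "bij h" "h 1 = 1" "h 2 = 2" "r' = relabel h r" "s' = relabel h s"
    using representatives_relabel[OF rs] by blast
  then show ?thesis
    unfolding class_compose_def eq using compose2_relabel[OF assms(1) _ _ _ assms(2)] by simp
qed

end

theory Submission
  imports Defs
begin

text \<open>Each product is computed on representatives of the isoclasses; the identities then reduce, by
  multilinearity, to equalities between posets on a disjoint union of three ground sets. For
  \<open>*\<close>, summing \<open>u\<close> and \<open>c\<close> removes the distinction whether some element of the first factor
  lies below one of the second, so both bracketings run over all orders on the triple union that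
  restrict to the given ones and never point from a later factor to an earlier one. For the two
  triangle products, the key point is that \<open>r \<triangle> s\<close> has the same maximal elements as \<open>s\<close>.\<close>

section \<open>Multilinearity\<close>

text \<open>Products of isoclasses are defined through posets on \<open>nat\<close> avoiding the
  labels 1 and 2 of the outer operation, while \<open>A\<close> and \<open>B\<close> live on an
  arbitrary type. Every formula is therefore computed on such labels and then moved to
  \<open>A\<close> and \<open>B\<close> along a map that is injective only on their ground set. The
  circle composition is given implicitly: \<open>circ_posets\<close> collects all orders with a
  prescribed contraction. Two facts make it computable. Expanding an isolated point has a unique
  solution, since any relation crossing between the two parts would be visible after contraction. In
  general, contraction recovers the poset that was expanded, so nested sums run over disjoint
  families and become one sum over a union. The same recovery, with restriction in place of
  contraction, serves the associativity of \<open>*\<close>. Multiplicities matter here: the sums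
  run over orders on a fixed ground set, several of which may be isomorphic, so index sets are
  matched by equalities or bijections of orders, not of classes.\<close>

text \<open>Writing a vector as a linear extension of \<open>basis\<close> gives it the form on
  which the linearity rules for \<open>bilin\<close> act.\<close>

lemma lin_ext_basis_id: "lin_ext basis x = x"
proof (rule poly_mapping_eqI)
  fix b
  have "Poly_Mapping.lookup (lin_ext basis x) b
      = (\<Sum>c\<in>Poly_Mapping.keys x. if c = b then Poly_Mapping.lookup x b else 0)"
    unfolding lin_ext_def basis_def Poly_Mapping.lookup_sum
    by (intro sum.cong) (auto simp: lookup_scale lookup_single)
  then show "Poly_Mapping.lookup (lin_ext basis x) b = Poly_Mapping.lookup x b"
    by (simp add: in_keys_iff)
qed

lemma lin_ext_swap:
  "lin_ext (\<lambda>a. lin_ext (\<lambda>b. g a b) y) x = lin_ext (\<lambda>b. lin_ext (\<lambda>a. g a b) x) y"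
  unfolding lin_ext_def scale_sum scale_scale
  by (subst sum.swap) (simp add: mult.commute)

lemma bilin_lin_ext_left: "bilin P D (lin_ext f x) z = lin_ext (\<lambda>b. bilin P D (f b) z) x"
  unfolding bilin_def by (rule lin_ext_lin_ext)

text \<open>The definition of \<open>bilin\<close> extends over the second argument inside the
  first, so linearity there needs the exchange of two finite sums and of their coefficients.\<close>

lemma bilin_lin_ext_right: "bilin P D z (lin_ext f x) = lin_ext (\<lambda>b. bilin P D z (f b)) x"
  unfolding bilin_def lin_ext_lin_ext by (rule lin_ext_swap)

lemma bilin_sum_left: "bilin P D (sum f S) z = (\<Sum>i\<in>S. bilin P D (f i) z)"
  unfolding bilin_def by (rule lin_ext_sum)

lemma bilin_sum_right: "bilin P D z (sum f S) = (\<Sum>i\<in>S. bilin P D z (f i))"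
proof -
  \<comment> \<open>With \<open>y\<close> expanded over the basis, \<open>bilin P D z\<close> is a
    single linear extension, which commutes with finite sums.\<close>
  have "bilin P D z y = lin_ext (\<lambda>\<beta>. bilin P D z (basis \<beta>)) y" for y
    by (subst lin_ext_basis_id[of y, symmetric]) (rule bilin_lin_ext_right)
  from this[of "sum f S"] this[of "f _"] show ?thesis by (simp add: lin_ext_sum)
qed

lemma bilin_basis:
  "bilin P D x y = lin_ext (\<lambda>a. lin_ext (\<lambda>b. bilin P D (basis a) (basis b)) y) x"
  by (simp add: bilin_def)

section \<open>Relabelling along partial injections\<close>

text \<open>Every relation lies in the square of its field, so the order axioms reduce to three
  pointwise conditions.\<close>

lemma Partial_order_iff:
  "Partial_order r \<longleftrightarrow> (\<forall>x\<in>Field r. (x, x) \<in> r) \<and>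
     (\<forall>x y z. (x, y) \<in> r \<longrightarrow> (y, z) \<in> r \<longrightarrow> (x, z) \<in> r) \<and>
     (\<forall>x y. (x, y) \<in> r \<longrightarrow> (y, x) \<in> r \<longrightarrow> x = y)"
  unfolding order_on_defs refl_on_def trans_def antisym_def by (auto intro: FieldI1 FieldI2)

lemma
  assumes "Partial_order r"
  shows Partial_order_refl: "\<And>x. x \<in> Field r \<Longrightarrow> (x, x) \<in> r"
    and Partial_order_trans: "\<And>x y z. (x, y) \<in> r \<Longrightarrow> (y, z) \<in> r \<Longrightarrow> (x, z) \<in> r"
    and Partial_order_antisym: "\<And>x y. (x, y) \<in> r \<Longrightarrow> (y, x) \<in> r \<Longrightarrow> x = y"
  using assms unfolding Partial_order_iff by blast+

lemma rel_eqI: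
  assumes "\<And>x y. x \<in> S \<Longrightarrow> y \<in> S \<Longrightarrow> (x, y) \<in> r \<longleftrightarrow> (x, y) \<in> s" "Field r \<subseteq> S" "Field s \<subseteq> S"
  shows "r = s"
proof -
  have "x \<in> S \<and> y \<in> S" if "(x, y) \<in> r \<union> s" for x y
    using that assms(2,3) by (auto intro: FieldI1 FieldI2)
  then show ?thesis using assms(1) by auto
qed

text \<open>The earlier relabelling facts take \<open>f\<close> injective on the whole type. No such
  map from \<open>'a\<close> to \<open>nat\<close> need exist, so they are redone for maps injective
  on a set that contains the ground set.\<close>

lemma relabel_mem_on:
  assumes "inj_on f S" "Field r \<subseteq> S" "x \<in> S" "y \<in> S"
  shows "(f x, f y) \<in> relabel f r \<longleftrightarrow> (x, y) \<in> r"
proof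
  assume "(f x, f y) \<in> relabel f r"
  then obtain a b where "(a, b) \<in> r" "f x = f a" "f y = f b" unfolding relabel_def by auto
  moreover from this have "a \<in> S" "b \<in> S" using assms(2) by (auto intro: FieldI1 FieldI2)
  ultimately show "(x, y) \<in> r" using assms by (simp add: inj_on_eq_iff)
qed (force simp: relabel_def)

lemma poset_iso_relabel_on:
  assumes "inj_on f (Field r)" shows "poset_iso r (relabel f r)"
  unfolding poset_iso_def
  by (rule exI[of _ f]) (use assms relabel_mem_on[OF assms] in \<open>auto simp: bij_betw_def\<close>)

lemma cls_relabel: "inj_on f (Field r) \<Longrightarrow> cls (relabel f r) = cls r"
  unfolding cls_def using isoclass_of_eqI[OF poset_iso_relabel_on] by metis

lemma relabel_memE:
  assumes "(u, v) \<in> relabel f r"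
  obtains x y where "u = f x" "v = f y" "(x, y) \<in> r" "x \<in> Field r" "y \<in> Field r"
  using assms unfolding relabel_def by (auto intro: FieldI1 FieldI2)

lemma Partial_order_relabel_on:
  assumes inj: "inj_on f (Field r)" and r: "Partial_order r"
  shows "Partial_order (relabel f r)"
  unfolding Partial_order_iff
proof (intro conjI allI impI ballI)
  fix u assume "u \<in> Field (relabel f r)"
  then show "(u, u) \<in> relabel f r"
    using Partial_order_refl[OF r] relabel_mem_on[OF inj] by auto
next
  fix u v w assume 1: "(u, v) \<in> relabel f r" "(v, w) \<in> relabel f r"
  obtain x y where x: "u = f x" "v = f y" "(x, y) \<in> r" "x \<in> Field r" "y \<in> Field r"
    using 1(1) by (rule relabel_memE)
  obtain y' z where z: "v = f y'" "w = f z" "(y', z) \<in> r" "y' \<in> Field r" "z \<in> Field r"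
    using 1(2) by (rule relabel_memE)
  have "y' = y" using x z inj by (simp add: inj_on_eq_iff)
  then have "(x, z) \<in> r" using x z Partial_order_trans[OF r] by blast
  then show "(u, w) \<in> relabel f r" using x z relabel_mem_on[OF inj] by auto
next
  fix u v assume 1: "(u, v) \<in> relabel f r" "(v, u) \<in> relabel f r"
  obtain x y where x: "u = f x" "v = f y" "(x, y) \<in> r" "x \<in> Field r" "y \<in> Field r"
    using 1(1) by (rule relabel_memE)
  then have "(y, x) \<in> r" using 1(2) relabel_mem_on[OF inj] by auto
  then show "u = v" using x Partial_order_antisym[OF r] by blast
qed

lemma finposet_relabel: "finposet r \<Longrightarrow> inj_on f (Field r) \<Longrightarrow> finposet (relabel f r)"
  using Partial_order_relabel_on[of f r] unfolding finposet_def by simp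

lemma relabel_union: "relabel f (r \<union> s) = relabel f r \<union> relabel f s"
  unfolding relabel_def by (rule image_Un)

lemma relabel_times: "relabel f (X \<times> Y) = f ` X \<times> f ` Y"
  unfolding relabel_def by force

lemma maximals_relabel_on:
  assumes inj: "inj_on f (Field r)" shows "maximals (relabel f r) = f ` maximals r"
  using relabel_mem_on[OF inj order_refl] inj unfolding maximals_def
  by (auto elim!: relabel_memE simp: inj_on_eq_iff image_iff intro: FieldI1 FieldI2) (metis FieldI2 inj_on_eq_iff)

lemma minimals_relabel_on:
  assumes inj: "inj_on f (Field r)" shows "minimals (relabel f r) = f ` minimals r"
  using relabel_mem_on[OF inj order_refl] inj unfolding minimals_def
  by (auto elim!: relabel_memE simp: inj_on_eq_iff image_iff intro: FieldI1 FieldI2) (metis FieldI1 inj_on_eq_iff)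

section \<open>Compositions with two-element posets\<close>

text \<open>An isolated point is comparable only to itself, so inserting \<open>s\<close> there
  creates no relation between \<open>s\<close> and \<open>r\<close>. The same holds for the two
  triangle compositions below.\<close>

lemma bullet_isolated:
  "a \<notin> Field r \<Longrightarrow> Field r \<inter> Field s = {} \<Longrightarrow> bullet (r \<union> {(a, a)}) a s = r \<union> s"
  unfolding bullet_def by (auto intro: FieldI1 FieldI2)

lemma btriangle_isolated:
  "a \<notin> Field r \<Longrightarrow> Field r \<inter> Field s = {} \<Longrightarrow> btriangle (r \<union> {(a, a)}) a s = r \<union> s"
  unfolding btriangle_def by (auto intro: FieldI1 FieldI2)

lemma btriangledown_isolated:
  "a \<notin> Field r \<Longrightarrow> Field r \<inter> Field s = {} \<Longrightarrow> btriangledown (r \<union> {(a, a)}) a s = r \<union> s"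
  unfolding btriangledown_def by (auto intro: FieldI1 FieldI2)

lemma Field_single: "Field {(a, a)} = {a}"
  by (auto simp: Field_def)

lemma Partial_order_union:
  assumes "Partial_order r" "Partial_order s" "Field r \<inter> Field s = {}"
  shows "Partial_order (r \<union> s)"
proof -
  \<comment> \<open>By disjointness each related pair lies wholly in one of the two ground sets, so
    a chain of two relations never mixes \<open>r\<close> and \<open>s\<close>.\<close>
  have *: "x \<in> Field r \<and> y \<in> Field r \<and> (x, y) \<in> r \<and> x \<notin> Field s \<and> y \<notin> Field s \<or>
      x \<in> Field s \<and> y \<in> Field s \<and> (x, y) \<in> s \<and> x \<notin> Field r \<and> y \<notin> Field r"
    if "(x, y) \<in> r \<union> s" for x y
    using that assms(3) FieldI1[of x y] FieldI2[of x y] by blast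
  show ?thesis
    unfolding Partial_order_iff
  proof (intro conjI allI impI ballI)
    fix x assume "x \<in> Field (r \<union> s)"
    then show "(x, x) \<in> r \<union> s"
      using assms(1,2)[THEN Partial_order_refl] by auto
  next
    fix x y z assume "(x, y) \<in> r \<union> s" "(y, z) \<in> r \<union> s"
    from this[THEN *] show "(x, z) \<in> r \<union> s"
      using assms(1,2)[THEN Partial_order_trans] by blast
  next
    fix x y assume "(x, y) \<in> r \<union> s" "(y, x) \<in> r \<union> s"
    from this[THEN *] show "x = y"
      using assms(1,2)[THEN Partial_order_antisym] by blast
  qed
qed

text \<open>A relation of \<open>t\<close> between a point of \<open>s\<close> and a point of
  \<open>r\<close> would survive contraction as a relation between \<open>a\<close> and that point,
  but \<open>a\<close> is isolated. Without such relations, contraction adds nothing inside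
  \<open>Field r\<close>, so \<open>t\<close> is determined there by \<open>r\<close> and elsewhere
  by \<open>s\<close>.\<close>

lemma circ_posets_isolated:
  assumes "Partial_order r" "Partial_order s" "a \<notin> Field r" "Field r \<inter> Field s = {}"
  shows "circ_posets (r \<union> {(a, a)}) a s = {r \<union> s}"
proof (intro equalityI subsetI)
  fix t assume t: "t \<in> circ_posets (r \<union> {(a, a)}) a s"
  have F: "Field t = Field r \<union> Field s" and R: "Restr t (Field s) = s"
    and C: "contract t (Field s) a = r \<union> {(a, a)}"
    using t assms(3) unfolding circ_posets_def by (auto simp: Field_single)
  have 1: "(a, y) \<notin> r" "(y, a) \<notin> r" for y using assms(3) by (auto intro: FieldI1 FieldI2)
  have 2: "(b, y) \<notin> t" "(y, b) \<notin> t" if "b \<in> Field s" "y \<in> Field r" for b y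
  proof -
    have y: "y \<in> Field t - Field s" "y \<noteq> a" using that F assms(3,4) by auto
    have "(a, y) \<notin> contract t (Field s) a" "(y, a) \<notin> contract t (Field s) a"
      unfolding C using 1 y by auto
    then show "(b, y) \<notin> t" "(y, b) \<notin> t" using that y unfolding contract_def by auto
  qed
  have "(x, y) \<in> t \<longleftrightarrow> (x, y) \<in> r" if "x \<in> Field r" "y \<in> Field r" for x y
  proof -
    have "(x, y) \<in> t \<longleftrightarrow> (x, y) \<in> contract t (Field s) a"
      unfolding contract_def using that 2 F assms(3,4) by auto
    then show ?thesis unfolding C using that assms(3) by auto
  qed
  moreover have "(x, y) \<in> t \<longleftrightarrow> (x, y) \<in> s" if "x \<in> Field s" "y \<in> Field s" for x y
    using R that by blast
  ultimately have "(x, y) \<in> t \<longleftrightarrow> (x, y) \<in> r \<union> s"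
    if "x \<in> Field r \<union> Field s" "y \<in> Field r \<union> Field s" for x y
    using that 2 assms(4) FieldI1[of x y] FieldI2[of x y] by auto
  then have "t = r \<union> s" by (rule rel_eqI[of "Field r \<union> Field s"]) (auto simp: F)
  then show "t \<in> {r \<union> s}" by simp
next
  fix t assume "t \<in> {r \<union> s}"
  then have t: "t = r \<union> s" by simp
  have "Partial_order t" unfolding t using assms by (intro Partial_order_union)
  moreover have "Field t = Field (r \<union> {(a, a)}) - {a} \<union> Field s"
    using assms(3) by (auto simp: t Field_single)
  moreover have "Restr t (Field s) = s"
    unfolding t using assms(4) by (auto intro: FieldI1 FieldI2)
  moreover have "convex_in t (Field s)"
    unfolding convex_in_def t using assms(4) by (auto intro: FieldI1 FieldI2)
  moreover have "contract t (Field s) a = r \<union> {(a, a)}"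
    unfolding contract_def t using assms(4) by (auto intro: FieldI1 FieldI2)
  ultimately show "t \<in> circ_posets (r \<union> {(a, a)}) a s" unfolding circ_posets_def by blast
qed

text \<open>Equations between restrictions and products of sets distribute over unions of ground
  sets, which makes nested products comparable.\<close>

lemma star_posets_alt:
  "t \<in> star_posets r s \<longleftrightarrow> Partial_order t \<and> Field t = Field r \<union> Field s \<and>
     Restr t (Field r) = r \<and> Restr t (Field s) = s \<and> t \<inter> Field s \<times> Field r = {}"
proof -
  have "Restr t (Field q) = q \<longleftrightarrow>
      (\<forall>x\<in>Field q. \<forall>y\<in>Field q. (x, y) \<in> t \<longleftrightarrow> (x, y) \<in> q)" for q :: "'a rel"
    by (auto intro: FieldI1 FieldI2)
  moreover have "t \<inter> Field s \<times> Field r = {} \<longleftrightarrow> (\<forall>x\<in>Field r. \<forall>y\<in>Field s. (y, x) \<notin> t)" by auto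
  ultimately show ?thesis unfolding star_posets_def by simp
qed

lemma finite_star_posets:
  assumes "finite (Field r)" "finite (Field s)" shows "finite (star_posets r s)"
proof (rule finite_subset)
  show "star_posets r s \<subseteq> Pow ((Field r \<union> Field s) \<times> (Field r \<union> Field s))"
    unfolding star_posets_def by (auto dest: FieldI1 FieldI2)
qed (use assms in simp)

lemma finposet_star: "finposet r \<Longrightarrow> finposet s \<Longrightarrow> t \<in> star_posets r s \<Longrightarrow> finposet t"
  unfolding finposet_def star_posets_def by auto

text \<open>Each \<open>T\<close> on the right arises from exactly one \<open>t\<close>, its
  contraction along \<open>Field s\<close>. No point of \<open>s\<close> lies below a point of
  \<open>r\<close>, so contraction changes nothing inside \<open>Field r\<close> and only records
  which points of \<open>r\<close> lie below some point of \<open>s\<close>.\<close>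

lemma circ_posets_star:
  assumes "Partial_order s" "Field s \<noteq> {}" "a \<notin> Field r" "Field r \<inter> Field s = {}"
  shows "(\<Union>t\<in>star_posets r {(a, a)}. circ_posets t a s) = star_posets r s"
proof (intro equalityI subsetI)
  fix T assume "T \<in> (\<Union>t\<in>star_posets r {(a, a)}. circ_posets t a s)"
  then obtain t where t: "t \<in> star_posets r {(a, a)}" and T: "T \<in> circ_posets t a s" by blast
  have F: "Field T = Field r \<union> Field s" and R: "Restr T (Field s) = s"
    and C: "contract T (Field s) a = t" and P: "Partial_order T"
    using t T assms(3) unfolding circ_posets_def star_posets_def by (auto simp: Field_single)
  have 2: "(b, y) \<notin> T" if "b \<in> Field s" "y \<in> Field r" for b y
  proof -
    have "(a, y) \<notin> contract T (Field s) a"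
      unfolding C using t that unfolding star_posets_def by (simp add: Field_single)
    moreover have "y \<in> Field T - Field s" using that F assms(4) by auto
    ultimately show ?thesis using that unfolding contract_def by auto
  qed
  have "(x, y) \<in> T \<longleftrightarrow> (x, y) \<in> r" if "x \<in> Field r" "y \<in> Field r" for x y
  proof -
    have "(x, y) \<in> T \<longleftrightarrow> (x, y) \<in> contract T (Field s) a"
      unfolding contract_def using that 2 F assms(3,4) by auto
    then show ?thesis unfolding C using that t unfolding star_posets_def by simp
  qed
  moreover have "(x, y) \<in> T \<longleftrightarrow> (x, y) \<in> s" if "x \<in> Field s" "y \<in> Field s" for x y
    using R that by blast
  ultimately show "T \<in> star_posets r s" using P F 2 unfolding star_posets_def by blast
next
  fix T assume T: "T \<in> star_posets r s"
  let ?t = "contract T (Field s) a"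
  have P: "Partial_order T" and F: "Field T = Field r \<union> Field s"
    and r: "\<And>x y. x \<in> Field r \<Longrightarrow> y \<in> Field r \<Longrightarrow> (x, y) \<in> T \<longleftrightarrow> (x, y) \<in> r"
    and s: "\<And>x y. x \<in> Field s \<Longrightarrow> y \<in> Field s \<Longrightarrow> (x, y) \<in> T \<longleftrightarrow> (x, y) \<in> s"
    and N: "\<And>x y. x \<in> Field r \<Longrightarrow> y \<in> Field s \<Longrightarrow> (y, x) \<notin> T"
    using T unfolding star_posets_def by blast+
  have D: "Field T - Field s = Field r" using F assms(4) by auto
  \<comment> \<open>By \<open>N\<close>, the clauses of \<open>contract\<close> that need a point of
    \<open>s\<close> below a point of \<open>r\<close> are empty.\<close>
  have t: "(x, y) \<in> ?t \<longleftrightarrow> x = a \<and> y = a \<or> x \<in> Field r \<and> y = a \<and> (\<exists>b\<in>Field s. (x, b) \<in> T)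
      \<or> x \<in> Field r \<and> y \<in> Field r \<and> (x, y) \<in> T" for x y
    unfolding contract_def D using N by auto
  have refl: "(x, x) \<in> ?t" if "x \<in> Field r \<union> {a}" for x
    using that Partial_order_refl[OF P, of x] F by (auto simp: t)
  have Ft: "Field ?t = Field r \<union> {a}"
  proof
    show "Field ?t \<subseteq> Field r \<union> {a}"
      by (intro subsetI, unfold Field_iff[of _ ?t] t) blast
    show "Field r \<union> {a} \<subseteq> Field ?t" by (auto intro: FieldI1 refl)
  qed
  have "Partial_order ?t"
    unfolding Partial_order_iff
    unfolding Ft
  proof (intro conjI allI impI ballI)
    fix x y z assume "(x, y) \<in> ?t" "(y, z) \<in> ?t"
    then show "(x, z) \<in> ?t" unfolding t using Partial_order_trans[OF P] assms(3) by blast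
  next
    fix x y assume "(x, y) \<in> ?t" "(y, x) \<in> ?t"
    then show "x = y" unfolding t using Partial_order_antisym[OF P] assms(3) by blast
  qed (rule refl)
  then have "?t \<in> star_posets r {(a, a)}"
    unfolding star_posets_def mem_Collect_eq Ft Field_single using r assms(3) by (auto simp: t)
  moreover have "T \<in> circ_posets ?t a s"
  proof -
    have "Restr T (Field s) = s" using s by (auto intro: FieldI1 FieldI2)
    \<comment> \<open>An intermediate point in \<open>Field r\<close> would lie above a point of
      \<open>s\<close>, against \<open>N\<close>.\<close>
    moreover have "convex_in T (Field s)"
      unfolding convex_in_def using F N by (blast dest: FieldI1 FieldI2)
    ultimately show ?thesis
      unfolding circ_posets_def using P F Ft assms(3) by auto
  qed
  ultimately show "T \<in> (\<Union>t\<in>star_posets r {(a, a)}. circ_posets t a s)" by blast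
qed

text \<open>The expanded poset is recovered from any member of \<open>circ_posets\<close> as its
  contraction.\<close>

lemma circ_posets_disjoint: "t \<noteq> t' \<Longrightarrow> circ_posets t a s \<inter> circ_posets t' a s = {}"
  unfolding circ_posets_def by auto

text \<open>The new point 2 lies below no element of \<open>r\<close>, which is the condition in \<^const>\<open>star_posets\<close>;
  whether it lies above one decides between \<open>u\<close> and \<open>c\<close>.\<close>

lemma circ_posets_u_c:
  assumes "finposet r" "Field r \<inter> {1, 2} = {}"
  shows "circ_posets u_poset 1 r \<union> circ_posets c_poset 1 r = star_posets r {(2, 2)}"
proof (rule set_eqI)
  fix t
  have Fu: "Field u_poset = {1, 2}" "Field c_poset = {1, 2}"
    unfolding u_poset_def c_poset_def Field_def by auto
  have "contract t (Field r) 1 = u_poset \<or> contract t (Field r) 1 = c_poset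
      \<longleftrightarrow> (\<forall>x\<in>Field r. (2, x) \<notin> t)"
    if F: "Field t = Field r \<union> {2}" and P: "Partial_order t"
  proof -
    have D: "Field t - Field r = {2}" using F assms(2) by auto
    have 2: "(2, 2) \<in> t" using Partial_order_refl[OF P] F by auto
    \<comment> \<open>Outside \<open>Field r\<close> only 2 remains, so the contraction lives on the
      points 1 and 2, and only the comparisons between these two are open.\<close>
    have mem: "(x, y) \<in> contract t (Field r) 1 \<longleftrightarrow> x = 1 \<and> y = 1 \<or> x = 2 \<and> y = 2
        \<or> x = 1 \<and> y = 2 \<and> (\<exists>b\<in>Field r. (b, 2) \<in> t)
        \<or> x = 2 \<and> y = 1 \<and> (\<exists>b\<in>Field r. (2, b) \<in> t)" for x y
      unfolding contract_def D using 2 by simp blast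
    show ?thesis
    proof (cases "\<exists>b\<in>Field r. (2, b) \<in> t")
      case True
      then have "(2, 1) \<in> contract t (Field r) 1" by (simp add: mem del: One_nat_def)
      moreover have "(2, 1) \<notin> u_poset" "(2, 1) \<notin> c_poset" by (simp_all add: u_poset_def c_poset_def)
      ultimately show ?thesis using True by blast
    next
      case False
      then have "contract t (Field r) 1 = (if \<exists>b\<in>Field r. (b, 2) \<in> t then c_poset else u_poset)"
        by (auto simp: mem u_poset_def c_poset_def simp del: One_nat_def)
      then show ?thesis using False by auto
    qed
  qed
  moreover have "convex_in t (Field r)"
    if F: "Field t = Field r \<union> {2}" and "\<forall>x\<in>Field r. (2, x) \<notin> t"
    unfolding convex_in_def using that by (blast dest: FieldI1 FieldI2)
  moreover have "Restr t (Field r) = r \<longleftrightarrow>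
      (\<forall>x\<in>Field r. \<forall>y\<in>Field r. (x, y) \<in> t \<longleftrightarrow> (x, y) \<in> r)"
    by (auto intro: FieldI1 FieldI2)
  moreover have "(2, 2) \<in> t" if "Field t = Field r \<union> {2}" "Partial_order t"
    using Partial_order_refl[OF that(2)] that(1) by auto
  moreover have "{1, 2} - {1} \<union> Field r = Field r \<union> {2}" by auto
  ultimately show "t \<in> circ_posets u_poset 1 r \<union> circ_posets c_poset 1 r
      \<longleftrightarrow> t \<in> star_posets r {(2, 2)}"
    unfolding circ_posets_def star_posets_def Un_iff mem_Collect_eq Fu Field_single by auto
qed

section \<open>Posets on a disjoint union\<close>

text \<open>Nothing leads from \<open>s\<close> back to \<open>r\<close>, so the only new composites
  that transitivity demands are \<open>r\<close> followed by \<open>X\<close> and \<open>X\<close>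
  followed by \<open>s\<close>. All explicit product posets are instances, with different cross
  relations \<open>X\<close>.\<close>

lemma star_posets_between:
  assumes r: "Partial_order r" and s: "Partial_order s" and disj: "Field r \<inter> Field s = {}"
    and X: "X \<subseteq> Field r \<times> Field s"
    and rX: "\<And>x y z. (x, y) \<in> r \<Longrightarrow> (y, z) \<in> X \<Longrightarrow> (x, z) \<in> X"
    and Xs: "\<And>x y z. (x, y) \<in> X \<Longrightarrow> (y, z) \<in> s \<Longrightarrow> (x, z) \<in> X"
  shows "r \<union> s \<union> X \<in> star_posets r s"
proof -
  let ?t = "r \<union> s \<union> X"
  have r': "x \<in> Field r \<and> y \<in> Field r \<and> x \<notin> Field s \<and> y \<notin> Field s" if "(x, y) \<in> r" for x y
    using that disj FieldI1[OF that] FieldI2[OF that] by blast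
  have s': "x \<in> Field s \<and> y \<in> Field s \<and> x \<notin> Field r \<and> y \<notin> Field r" if "(x, y) \<in> s" for x y
    using that disj FieldI1[OF that] FieldI2[OF that] by blast
  have X': "x \<in> Field r \<and> y \<in> Field s \<and> x \<notin> Field s \<and> y \<notin> Field r" if "(x, y) \<in> X" for x y
    using that disj X by blast
  have F: "Field ?t = Field r \<union> Field s"
    using X by (auto simp: Field_iff[of _ X] Field_Un)
  have "Partial_order ?t"
    unfolding Partial_order_iff
    unfolding F
  proof (intro conjI allI impI ballI)
    fix x assume "x \<in> Field r \<union> Field s"
    then show "(x, x) \<in> ?t" using Partial_order_refl[OF r] Partial_order_refl[OF s] by auto
  next
    fix x y z assume "(x, y) \<in> ?t" "(y, z) \<in> ?t"
    then show "(x, z) \<in> ?t"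
      using Partial_order_trans[OF r, of x y z] Partial_order_trans[OF s, of x y z] rX[of x y z]
        Xs[of x y z] r'[of x y] s'[of x y] X'[of x y] r'[of y z] s'[of y z] X'[of y z]
      by auto
  next
    fix x y assume "(x, y) \<in> ?t" "(y, x) \<in> ?t"
    then show "x = y"
      using Partial_order_antisym[OF r, of x y] Partial_order_antisym[OF s, of x y]
        r'[of x y] s'[of x y] X'[of x y] r'[of y x] s'[of y x] X'[of y x]
      by auto
  qed
  then show ?thesis
    unfolding star_posets_def using F r' s' X' by blast
qed

lemma poset_union_star:
  assumes "Partial_order r" "Partial_order s" "Field r \<inter> Field s = {}"
  shows "poset_union r s \<in> star_posets r s"
  using star_posets_between[OF assms, of "{}"] by (simp add: poset_union_def)

lemma poset_down_star:
  assumes "Partial_order r" "Partial_order s" "Field r \<inter> Field s = {}"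
  shows "poset_down r s \<in> star_posets r s"
  unfolding poset_down_def
  by (rule star_posets_between[OF assms]) (auto intro: FieldI1 FieldI2)

text \<open>A maximal element of \<open>s\<close> has only itself above it, so following a cross
  relation by a relation of \<open>s\<close> gives nothing new.\<close>

lemma poset_tri_star:
  assumes "Partial_order r" "Partial_order s" "Field r \<inter> Field s = {}"
  shows "poset_tri r s \<in> star_posets r s"
  unfolding poset_tri_def
  by (rule star_posets_between[OF assms]) (auto simp: maximals_def intro: FieldI1)

text \<open>The cross relations run from \<open>s\<close> up to \<open>r\<close>, hence the
  exchanged factors in \<open>star_posets s r\<close>.\<close>

lemma poset_tridown_star:
  assumes "Partial_order r" "Partial_order s" "Field r \<inter> Field s = {}"
  shows "poset_tridown r s \<in> star_posets s r"
proof -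
  have "x = y" if "(x, y) \<in> s" "y \<in> minimals s" for x y
    using that by (simp add: minimals_def)
  moreover have "minimals s \<subseteq> Field s" by (auto simp: minimals_def)
  ultimately have "s \<union> r \<union> minimals s \<times> Field r \<in> star_posets s r"
    using assms by (intro star_posets_between) (blast intro: FieldI2)+
  then show ?thesis by (simp add: poset_tridown_def Un_commute)
qed

lemma Field_star_posets: "t \<in> star_posets r s \<Longrightarrow> Field t = Field r \<union> Field s"
  by (simp add: star_posets_def)

lemma
  assumes "finposet r" "finposet s" "Field r \<inter> Field s = {}"
  shows finposet_union: "finposet (poset_union r s)"
    and finposet_down: "finposet (poset_down r s)"
    and finposet_tri: "finposet (poset_tri r s)"
    and finposet_tridown: "finposet (poset_tridown r s)"
    and Field_union: "Field (poset_union r s) = Field r \<union> Field s"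
    and Field_down: "Field (poset_down r s) = Field r \<union> Field s"
    and Field_tri: "Field (poset_tri r s) = Field r \<union> Field s"
    and Field_tridown: "Field (poset_tridown r s) = Field r \<union> Field s"
proof -
  have "Partial_order r" "Partial_order s" using assms by (simp_all add: finposet_def)
  note star = poset_union_star[OF this assms(3)] poset_down_star[OF this assms(3)]
    poset_tri_star[OF this assms(3)] poset_tridown_star[OF this assms(3)]
  show "finposet (poset_union r s)" "finposet (poset_down r s)" "finposet (poset_tri r s)"
    "finposet (poset_tridown r s)"
    using star assms(1,2) finposet_star by blast+
  show "Field (poset_union r s) = Field r \<union> Field s" "Field (poset_down r s) = Field r \<union> Field s"
    "Field (poset_tri r s) = Field r \<union> Field s" "Field (poset_tridown r s) = Field r \<union> Field s"
    using star[THEN Field_star_posets] by auto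
qed

text \<open>The strict part of a finite order is acyclic, hence well-founded in both directions, and
  the ground set has a least candidate for each.\<close>

lemma
  assumes "finposet r"
  shows maximals_nonempty: "maximals r \<noteq> {}" and minimals_nonempty: "minimals r \<noteq> {}"
proof -
  have po: "Partial_order r" and fin: "finite (Field r)" and "Field r \<noteq> {}"
    using assms by (simp_all add: finposet_def)
  then obtain a where a: "a \<in> Field r" by blast
  have "r \<subseteq> Field r \<times> Field r" by (auto intro: FieldI1 FieldI2)
  then have fin: "finite (r - Id)" using fin by (meson finite_Diff finite_SigmaI finite_subset)
  have ac: "acyclic (r - Id)" using po by (rule partial_order_on_acyclic)
  obtain m where "m \<in> Field r" "\<And>y. (y, m) \<in> r - Id \<Longrightarrow> y \<notin> Field r"
    using wfE_min[OF finite_acyclic_wf[OF fin ac] a] by blast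
  then have "m \<in> minimals r" unfolding minimals_def by (auto intro: FieldI1)
  then show "minimals r \<noteq> {}" by blast
  obtain m where "m \<in> Field r" "\<And>y. (y, m) \<in> (r - Id)\<inverse> \<Longrightarrow> y \<notin> Field r"
    using wfE_min[OF finite_acyclic_wf_converse[OF fin ac] a] by blast
  then have "m \<in> maximals r" unfolding maximals_def by (auto intro: FieldI2)
  then show "maximals r \<noteq> {}" by blast
qed

text \<open>Since \<open>maximals s\<close> is nonempty, every point of \<open>r\<close> gets a
  strictly larger element, while no new relation starts in \<open>s\<close>.\<close>

lemma maximals_tri:
  assumes "finposet r" "finposet s" "Field r \<inter> Field s = {}"
  shows "maximals (poset_tri r s) = maximals s"
proof -
  obtain m where m: "m \<in> maximals s" using maximals_nonempty[OF assms(2)] by blast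
  then have "m \<in> Field s" by (simp add: maximals_def)
  then have *: "x \<notin> maximals (poset_tri r s)" if "x \<in> Field r" for x
    using that m assms(3) unfolding maximals_def poset_tri_def by auto
  have "x \<in> maximals (poset_tri r s) \<longleftrightarrow> x \<in> maximals s" if "x \<in> Field s" for x
    using that assms(3) Field_tri[OF assms] unfolding maximals_def
    by (auto simp: poset_tri_def dest: FieldI1)
  moreover have "maximals (poset_tri r s) \<subseteq> Field r \<union> Field s" "maximals s \<subseteq> Field s"
    using Field_tri[OF assms] by (auto simp: maximals_def)
  ultimately show ?thesis using * by blast
qed

lemma minimals_tridown:
  assumes "finposet r" "finposet s" "Field r \<inter> Field s = {}"
  shows "minimals (poset_tridown r s) = minimals s"
proof -
  obtain m where m: "m \<in> minimals s" using minimals_nonempty[OF assms(2)] by blast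
  then have "m \<in> Field s" by (simp add: minimals_def)
  then have *: "x \<notin> minimals (poset_tridown r s)" if "x \<in> Field r" for x
    using that m assms(3) unfolding minimals_def poset_tridown_def by auto
  have "x \<in> minimals (poset_tridown r s) \<longleftrightarrow> x \<in> minimals s" if "x \<in> Field s" for x
    using that assms(3) Field_tridown[OF assms] unfolding minimals_def
    by (auto simp: poset_tridown_def dest: FieldI2)
  moreover have "minimals (poset_tridown r s) \<subseteq> Field r \<union> Field s" "minimals s \<subseteq> Field s"
    using Field_tridown[OF assms] by (auto simp: minimals_def)
  ultimately show ?thesis using * by blast
qed

section \<open>Products of isoclasses\<close>

text \<open>Transfers a computation on admissible \<open>nat\<close> representatives to posets over
  any type. \<open>\<Phi>\<close> is the computed value as a function of the representatives, and
  the last hypothesis says that renaming \<open>A\<close> and \<open>B\<close> does not change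
  it.\<close>

lemma bilin_cls_eqI:
  fixes A B :: "'a rel" and \<Phi> :: "nat rel \<Rightarrow> nat rel \<Rightarrow> isoclass \<Rightarrow>\<^sub>0 'k::field"
  assumes P: "equivariant P" and D: "\<And>d. d \<in> Poly_Mapping.keys D \<Longrightarrow> Field d = {1, 2}"
    and AB: "finposet A" "finposet B" "Field A \<inter> Field B = {}"
    and compose: "\<And>r s. finposet r \<Longrightarrow> finposet s \<Longrightarrow> Field r \<inter> Field s = {} \<Longrightarrow>
      Field r \<inter> {1, 2} = {} \<Longrightarrow> Field s \<inter> {1, 2} = {} \<Longrightarrow> lin_ext cls (compose2 P D r s) = \<Phi> r s"
    and \<Phi>: "\<And>f. inj_on f (Field A \<union> Field B) \<Longrightarrow> \<Phi> (relabel f A) (relabel f B) = v"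
  shows "bilin P D (cls A) (cls B) = v"
proof -
  have "finite (Field A \<union> Field B)" using AB by (simp add: finposet_def)
  then obtain g :: "'a \<Rightarrow> nat" where g: "inj_on g (Field A \<union> Field B)"
    using finite_imp_inj_to_nat_seg by blast
  \<comment> \<open>The shift by 3 keeps the new labels away from 1 and 2.\<close>
  define f where "f x = g x + 3" for x
  have inj: "inj_on f (Field A \<union> Field B)" using g by (simp add: f_def inj_on_def)
  then have injA: "inj_on f (Field A)" and injB: "inj_on f (Field B)"
    by (auto intro: inj_on_subset)
  have fin: "finposet (relabel f A)" "finposet (relabel f B)"
    using AB injA injB by (simp_all add: finposet_relabel)
  have disj: "Field (relabel f A) \<inter> Field (relabel f B) = {}"
    using AB(3) inj by (simp add: inj_on_image_Int[symmetric])
  have avoid: "Field (relabel f A) \<inter> {1, 2} = {}" "Field (relabel f B) \<inter> {1, 2} = {}"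
    by (auto simp: f_def)
  have "bilin P D (cls A) (cls B) = bilin P D (cls (relabel f A)) (cls (relabel f B))"
    by (simp only: cls_relabel[OF injA] cls_relabel[OF injB])
  also have "\<dots> = class_compose P D (isoclass_of (relabel f A)) (isoclass_of (relabel f B))"
    by (simp add: bilin_def cls_def)
  also have "\<dots> = lin_ext cls (compose2 P D (relabel f A) (relabel f B))"
    by (rule class_compose_eq[OF P D fin disj avoid])
  also have "\<dots> = \<Phi> (relabel f A) (relabel f B)"
    by (rule compose[OF fin disj avoid])
  also have "\<dots> = v" by (rule \<Phi>[OF inj])
  finally show ?thesis .
qed

lemma Field_two_element:
  "Field u_poset = {1, 2}" "Field c_poset = {1, 2}" "Field c'_poset = {1, 2}"
  unfolding u_poset_def c_poset_def c'_poset_def Field_def by auto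

lemma keys_basis: "Poly_Mapping.keys (basis b :: 'b \<Rightarrow>\<^sub>0 'k::field) = {b}"
  by (simp add: basis_def)

lemma compose2_basis: "compose2 P (basis d) r s = lin_ext (\<lambda>t. P t 2 s) (P d 1 r)"
  by (simp add: compose2_def)

text \<open>Since \<open>u = {(2, 2)} \<union> {(1, 1)}\<close>, both compositions insert a poset at an isolated point.\<close>

lemma bilin_u_cls:
  fixes A B :: "'a rel" and P :: "(nat, 'k::field) pcomp"
  assumes P: "equivariant P"
    and isolated: "\<And>r s a. finposet r \<Longrightarrow> finposet s \<Longrightarrow> a \<notin> Field r \<Longrightarrow> Field r \<inter> Field s = {} \<Longrightarrow>
      P (r \<union> {(a, a)}) a s = basis (r \<union> s)"
    and AB: "finposet A" "finposet B" "Field A \<inter> Field B = {}"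
  shows "bilin P (basis u_poset) (cls A) (cls B) = cls (poset_union A B)"
proof (rule bilin_cls_eqI[OF P _ AB, where \<Phi> = "\<lambda>r s. cls (poset_union r s)"])
  fix r s :: "nat rel"
  assume rs: "finposet r" "finposet s" "Field r \<inter> Field s = {}" "Field r \<inter> {1, 2} = {}"
  have u: "u_poset = {(2, 2)} \<union> {(1, 1)}" by (auto simp: u_poset_def)
  have "P u_poset 1 r = basis ({(2, 2)} \<union> r)"
    unfolding u using rs by (intro isolated finposet_singleton) (auto simp: Field_single)
  then have "P u_poset 1 r = basis (r \<union> {(2, 2)})" by (simp add: Un_commute)
  moreover have "P (r \<union> {(2, 2)}) 2 s = basis (r \<union> s)"
    using rs by (intro isolated) auto
  ultimately show "lin_ext cls (compose2 P (basis u_poset) r s) = cls (poset_union r s)"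
    by (simp add: compose2_basis poset_union_def)
next
  fix f :: "'a \<Rightarrow> nat" assume "inj_on f (Field A \<union> Field B)"
  then have "inj_on f (Field (poset_union A B))" using Field_union[OF AB] by simp
  from cls_relabel[OF this] show "cls (poset_union (relabel f A) (relabel f B)) = cls (poset_union A B)"
    by (simp add: poset_union_def relabel_union)
qed (simp add: keys_basis Field_two_element)

lemma bilin_u:
  fixes A B :: "'a rel"
  assumes "finposet A" "finposet B" "Field A \<inter> Field B = {}"
  shows "bilin Circ (basis u_poset) (cls A) (cls B) = (cls (poset_union A B) :: isoclass \<Rightarrow>\<^sub>0 'k::field)"
    and "bilin Bullet (basis u_poset) (cls A) (cls B) = (cls (poset_union A B) :: isoclass \<Rightarrow>\<^sub>0 'k)"
    and "bilin BTriangle (basis u_poset) (cls A) (cls B) = (cls (poset_union A B) :: isoclass \<Rightarrow>\<^sub>0 'k)"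
    and "bilin BTriangledown (basis u_poset) (cls A) (cls B)
      = (cls (poset_union A B) :: isoclass \<Rightarrow>\<^sub>0 'k)"
  by (rule bilin_u_cls[OF _ _ assms], rule equivariant_pcomps,
      simp add: Circ_def Bullet_def BTriangle_def BTriangledown_def finposet_def
        circ_posets_isolated[simplified] bullet_isolated[simplified] btriangle_isolated[simplified]
        btriangledown_isolated[simplified])+

text \<open>Inserting \<open>r\<close> at 1 puts all of \<open>r\<close> below the remaining point
  2; inserting \<open>s\<close> at 2 then puts all of \<open>s\<close> above everything that was
  below 2.\<close>

lemma bilin_Bullet_c:
  fixes A B :: "'a rel"
  assumes AB: "finposet A" "finposet B" "Field A \<inter> Field B = {}"
  shows "bilin Bullet (basis c_poset) (cls A) (cls B) = (cls (poset_down A B) :: isoclass \<Rightarrow>\<^sub>0 'k::field)"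
proof (rule bilin_cls_eqI[OF equivariant_pcomps(2) _ AB, where \<Phi> = "\<lambda>r s. cls (poset_down r s)"])
  fix r s :: "nat rel"
  assume rs: "finposet r" "finposet s" "Field r \<inter> Field s = {}"
    "Field r \<inter> {1, 2} = {}" "Field s \<inter> {1, 2} = {}"
  have 2: "(2, x) \<notin> r" "(x, 2) \<notin> r" for x using rs(4) by (auto intro: FieldI1 FieldI2)
  have "bullet c_poset 1 r = poset_down r {(2, 2)}"
    unfolding bullet_def Field_two_element by (auto simp: c_poset_def poset_down_def Field_single)
  moreover have "Field (poset_down r {(2, 2)}) = Field r \<union> {2}"
    using rs Field_down[OF rs(1) finposet_singleton[of 2]] by (simp add: Field_single)
  then have "bullet (poset_down r {(2, 2)}) 2 s = poset_down r s"
    unfolding bullet_def using rs(4) 2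
    by (auto simp: poset_down_def Field_single intro: FieldI1 FieldI2)
  ultimately show "lin_ext cls (compose2 Bullet (basis c_poset) r s) = cls (poset_down r s)"
    by (simp add: compose2_basis Bullet_def)
next
  fix f :: "'a \<Rightarrow> nat" assume "inj_on f (Field A \<union> Field B)"
  then have "inj_on f (Field (poset_down A B))" using Field_down[OF AB] by simp
  from cls_relabel[OF this] show "cls (poset_down (relabel f A) (relabel f B)) = cls (poset_down A B)"
    by (simp add: poset_down_def relabel_union relabel_times)
qed (simp add: keys_basis Field_two_element)

text \<open>Nothing else lies below 1 in the chain, so the first insertion puts all of
  \<open>r\<close> below 2; the second, at the top point 2, brings in
  \<open>maximals s\<close>.\<close>

lemma bilin_BTriangle_c:
  fixes A B :: "'a rel"
  assumes AB: "finposet A" "finposet B" "Field A \<inter> Field B = {}"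
  shows "bilin BTriangle (basis c_poset) (cls A) (cls B) = (cls (poset_tri A B) :: isoclass \<Rightarrow>\<^sub>0 'k::field)"
proof (rule bilin_cls_eqI[OF equivariant_pcomps(3) _ AB, where \<Phi> = "\<lambda>r s. cls (poset_tri r s)"])
  fix r s :: "nat rel"
  assume rs: "finposet r" "finposet s" "Field r \<inter> Field s = {}"
    "Field r \<inter> {1, 2} = {}" "Field s \<inter> {1, 2} = {}"
  have 2: "(2, x) \<notin> r" "(x, 2) \<notin> r" for x using rs(4) by (auto intro: FieldI1 FieldI2)
  have max: "maximals {(2, 2)} = {2::nat}" "maximals s \<subseteq> Field s"
    by (auto simp: maximals_def Field_single)
  have "btriangle c_poset 1 r = poset_tri r {(2, 2)}"
    unfolding btriangle_def Field_two_element by (auto simp: c_poset_def poset_tri_def max)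
  moreover have "Field (poset_tri r {(2, 2)}) = Field r \<union> {2}"
    using rs Field_tri[OF rs(1) finposet_singleton[of 2]] by (simp add: Field_single)
  then have "btriangle (poset_tri r {(2, 2)}) 2 s = poset_tri r s"
    unfolding btriangle_def using rs(4) 2 max
    by (auto simp: poset_tri_def intro: FieldI1 FieldI2)
  ultimately show "lin_ext cls (compose2 BTriangle (basis c_poset) r s) = cls (poset_tri r s)"
    by (simp add: compose2_basis BTriangle_def)
next
  fix f :: "'a \<Rightarrow> nat" assume inj: "inj_on f (Field A \<union> Field B)"
  then have poset: "inj_on f (Field (poset_tri A B))" using Field_tri[OF AB] by simp
  have "inj_on f (Field B)" using inj by (auto intro: inj_on_subset)
  with cls_relabel[OF poset] show "cls (poset_tri (relabel f A) (relabel f B)) = cls (poset_tri A B)"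
    by (simp add: poset_tri_def relabel_union relabel_times maximals_relabel_on)
qed (simp add: keys_basis Field_two_element)

text \<open>In the reversed chain 2 lies below 1, so the first insertion puts all of
  \<open>r\<close> above 2; inserting \<open>s\<close> at 2 then leaves only
  \<open>minimals s\<close> below \<open>r\<close>.\<close>

lemma bilin_BTriangledown_c':
  fixes A B :: "'a rel"
  assumes AB: "finposet A" "finposet B" "Field A \<inter> Field B = {}"
  shows "bilin BTriangledown (basis c'_poset) (cls A) (cls B)
    = (cls (poset_tridown A B) :: isoclass \<Rightarrow>\<^sub>0 'k::field)"
proof (rule bilin_cls_eqI[OF equivariant_pcomps(4) _ AB, where \<Phi> = "\<lambda>r s. cls (poset_tridown r s)"])
  fix r s :: "nat rel"
  assume rs: "finposet r" "finposet s" "Field r \<inter> Field s = {}"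
    "Field r \<inter> {1, 2} = {}" "Field s \<inter> {1, 2} = {}"
  have 2: "(2, x) \<notin> r" "(x, 2) \<notin> r" for x using rs(4) by (auto intro: FieldI1 FieldI2)
  have min: "minimals {(2, 2)} = {2::nat}" "minimals s \<subseteq> Field s"
    by (auto simp: minimals_def Field_single)
  have "btriangledown c'_poset 1 r = poset_tridown r {(2, 2)}"
    unfolding btriangledown_def Field_two_element by (auto simp: c'_poset_def poset_tridown_def min)
  moreover have "Field (poset_tridown r {(2, 2)}) = Field r \<union> {2}"
    using rs Field_tridown[OF rs(1) finposet_singleton[of 2]] by (simp add: Field_single)
  then have "btriangledown (poset_tridown r {(2, 2)}) 2 s = poset_tridown r s"
    unfolding btriangledown_def using rs(4) 2 min
    by (auto simp: poset_tridown_def intro: FieldI1 FieldI2)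
  ultimately show "lin_ext cls (compose2 BTriangledown (basis c'_poset) r s) = cls (poset_tridown r s)"
    by (simp add: compose2_basis BTriangledown_def)
next
  fix f :: "'a \<Rightarrow> nat" assume inj: "inj_on f (Field A \<union> Field B)"
  then have poset: "inj_on f (Field (poset_tridown A B))" using Field_tridown[OF AB] by simp
  have "inj_on f (Field B)" using inj by (auto intro: inj_on_subset)
  with cls_relabel[OF poset] show "cls (poset_tridown (relabel f A) (relabel f B)) = cls (poset_tridown A B)"
    by (simp add: poset_tridown_def relabel_union relabel_times minimals_relabel_on)
qed (simp add: keys_basis Field_two_element)

text \<open>Contraction recovers the index at both stages, so the nested sums run over disjoint
  families and each order on the union occurs exactly once.\<close>

lemma compose2_Circ_u_c:
  assumes rs: "finposet r" "finposet s" "Field r \<inter> Field s = {}"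
    "Field r \<inter> {1, 2} = {}" "Field s \<inter> {1, 2} = {}"
  shows "lin_ext cls (compose2 Circ (basis u_poset + basis c_poset) r s)
    = (\<Sum>t\<in>star_posets r s. (cls t :: isoclass \<Rightarrow>\<^sub>0 'k::field))"
proof -
  let ?S = "star_posets r {(2, 2)}"
  have uc: "circ_posets u_poset 1 r \<union> circ_posets c_poset 1 r = ?S"
    by (rule circ_posets_u_c[OF rs(1,4)])
  have fin: "finite ?S" using rs(1) by (intro finite_star_posets) (simp_all add: finposet_def Field_single)
  have UN: "(\<Union>t\<in>?S. circ_posets t 2 s) = star_posets r s"
    using rs by (intro circ_posets_star) (auto simp: finposet_def)
  have fin': "finite (circ_posets t 2 s)" if "t \<in> ?S" for t
    using that rs(1,2) UN finite_star_posets[of r s] by (auto simp: finposet_def intro: finite_subset)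
  have "(1, 2) \<in> c_poset" "(1, 2) \<notin> u_poset" by (simp_all add: c_poset_def u_poset_def)
  then have "circ_posets u_poset 1 r \<inter> circ_posets c_poset 1 r = {}"
    by (intro circ_posets_disjoint) blast
  then have "Circ u_poset 1 r + Circ c_poset 1 r = (\<Sum>t\<in>?S. basis t :: nat rel \<Rightarrow>\<^sub>0 'k)"
    unfolding Circ_def uc[symmetric] using fin[folded uc] by (intro sum.union_disjoint[symmetric]) auto
  then have "lin_ext (\<lambda>d. Circ d 1 r) (basis u_poset + basis c_poset) = (\<Sum>t\<in>?S. basis t :: nat rel \<Rightarrow>\<^sub>0 'k)"
    by (simp only: lin_ext_add lin_ext_basis)
  then have "lin_ext cls (compose2 Circ (basis u_poset + basis c_poset) r s)
      = (\<Sum>t\<in>?S. \<Sum>T\<in>circ_posets t 2 s. cls T :: isoclass \<Rightarrow>\<^sub>0 'k)"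
    unfolding compose2_def by (simp add: lin_ext_sum Circ_def)
  also have "\<dots> = (\<Sum>T\<in>(\<Union>t\<in>?S. circ_posets t 2 s). cls T)"
    by (intro sum.UNION_disjoint[symmetric] ballI impI fin fin' circ_posets_disjoint)
  finally show ?thesis by (simp only: UN)
qed

text \<open>Makes the sum over \<open>star_posets\<close> invariant under renaming. A bijection of
  orders is required because isomorphic orders contribute separately to the sum.\<close>

lemma relabel_star_posets:
  assumes inj: "inj_on f (Field r \<union> Field s)"
  shows "bij_betw (relabel f) (star_posets r s) (star_posets (relabel f r) (relabel f s))"
proof -
  let ?F = "Field r \<union> Field s"
  have mem: "(f x, f y) \<in> relabel f q \<longleftrightarrow> (x, y) \<in> q" if "Field q \<subseteq> ?F" "x \<in> ?F" "y \<in> ?F" for q x y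
    using relabel_mem_on[OF inj that] .
  have "inj_on (relabel f) (star_posets r s)"
  proof (rule inj_onI)
    fix t t' assume "t \<in> star_posets r s" "t' \<in> star_posets r s" and eq: "relabel f t = relabel f t'"
    then have F: "Field t = ?F" "Field t' = ?F" by (simp_all add: Field_star_posets)
    then show "t = t'" using mem[of t] mem[of t'] eq by (intro rel_eqI[of ?F]) auto
  qed
  moreover have "relabel f t \<in> star_posets (relabel f r) (relabel f s)" if t: "t \<in> star_posets r s" for t
  proof -
    have F: "Field t = ?F" using t by (rule Field_star_posets)
    moreover have "Partial_order (relabel f t)"
      using t F inj by (intro Partial_order_relabel_on) (simp_all add: star_posets_def)
    ultimately show ?thesis using t unfolding star_posets_def by (simp add: mem image_Un)
  qed
  moreover have "T \<in> relabel f ` star_posets r s" if T: "T \<in> star_posets (relabel f r) (relabel f s)" for T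
  proof -
    \<comment> \<open>The preimage of \<open>T\<close> is its pullback along \<open>f\<close>, cut
      down to the ground set on which \<open>f\<close> is injective.\<close>
    define t where "t = {(x, y). x \<in> ?F \<and> y \<in> ?F \<and> (f x, f y) \<in> T}"
    have FT: "Field T = f ` ?F" using Field_star_posets[OF T] by (simp add: image_Un)
    have P: "Partial_order T" using T unfolding star_posets_def by blast
    have Ft: "Field t = ?F"
    proof
      show "Field t \<subseteq> ?F" by (auto simp: t_def Field_iff)
      have "(x, x) \<in> t" if "x \<in> ?F" for x
        using that Partial_order_refl[OF P, of "f x"] FT by (auto simp: t_def)
      then show "?F \<subseteq> Field t" by (auto intro: FieldI1)
    qed
    have "relabel f t = T"
    proof (rule rel_eqI[of "f ` ?F"])
      fix u v assume "u \<in> f ` ?F" "v \<in> f ` ?F"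
      then obtain x y where "u = f x" "v = f y" "x \<in> ?F" "y \<in> ?F" by blast
      then show "(u, v) \<in> relabel f t \<longleftrightarrow> (u, v) \<in> T" using mem[of t x y] Ft by (simp add: t_def)
    qed (simp_all add: Ft FT)
    moreover have "Partial_order t"
      unfolding Partial_order_iff
    proof (intro conjI allI impI ballI)
      fix x assume "x \<in> Field t"
      then show "(x, x) \<in> t" using Partial_order_refl[OF P, of "f x"] FT Ft by (auto simp: t_def)
    next
      fix x y z assume "(x, y) \<in> t" "(y, z) \<in> t"
      then show "(x, z) \<in> t" using Partial_order_trans[OF P, of "f x" "f y" "f z"] by (simp add: t_def)
    next
      fix x y assume "(x, y) \<in> t" "(y, x) \<in> t"
      then show "x = y"
        using Partial_order_antisym[OF P, of "f x" "f y"] inj by (simp add: t_def inj_on_eq_iff)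
    qed
    then have "t \<in> star_posets r s"
      using T Ft unfolding star_posets_def by (simp add: mem t_def)
    ultimately show ?thesis by blast
  qed
  ultimately show ?thesis unfolding bij_betw_def by blast
qed

lemma bilin_star:
  fixes A B :: "'a rel"
  assumes AB: "finposet A" "finposet B" "Field A \<inter> Field B = {}"
  shows "bilin Circ (basis u_poset + basis c_poset) (cls A) (cls B)
    = (\<Sum>C\<in>star_posets A B. (cls C :: isoclass \<Rightarrow>\<^sub>0 'k::field))"
proof (rule bilin_cls_eqI[OF equivariant_pcomps(1) _ AB, where \<Phi> = "\<lambda>r s. \<Sum>C\<in>star_posets r s. cls C"])
  fix d assume "d \<in> Poly_Mapping.keys (basis u_poset + basis c_poset :: nat rel \<Rightarrow>\<^sub>0 'k)"
  then have "d = u_poset \<or> d = c_poset"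
    using Poly_Mapping.keys_add[of "basis u_poset :: nat rel \<Rightarrow>\<^sub>0 'k" "basis c_poset"]
    by (auto simp: keys_basis)
  then show "Field d = {1, 2}" using Field_two_element by blast
next
  fix f :: "'a \<Rightarrow> nat" assume inj: "inj_on f (Field A \<union> Field B)"
  have "(\<Sum>C\<in>star_posets (relabel f A) (relabel f B). cls C :: isoclass \<Rightarrow>\<^sub>0 'k)
      = (\<Sum>C\<in>star_posets A B. cls (relabel f C))"
    by (rule sum.reindex_bij_betw[OF relabel_star_posets[OF inj], symmetric])
  also have "\<dots> = (\<Sum>C\<in>star_posets A B. cls C)"
    using inj by (intro sum.cong refl cls_relabel) (simp add: Field_star_posets)
  finally show "(\<Sum>C\<in>star_posets (relabel f A) (relabel f B). cls C :: isoclass \<Rightarrow>\<^sub>0 'k)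
      = (\<Sum>C\<in>star_posets A B. cls C)" .
qed (rule compose2_Circ_u_c)

section \<open>Identities for the products\<close>

lemma isoclass_of_surj: "\<exists>r :: nat rel. finposet r \<and> \<alpha> = isoclass_of r"
proof -
  obtain q :: "nat rel" where q: "finposet q" "Rep_isoclass \<alpha>
      = {(r, s :: nat rel). finposet r \<and> finposet s \<and> poset_iso r s} `` {q}"
    using Rep_isoclass[of \<alpha>] by (elim quotientE) simp
  then have "Rep_isoclass \<alpha> = Rep_isoclass (isoclass_of q)"
    unfolding Rep_isoclass_of[OF q(1)] by auto
  then show ?thesis using q(1) by (auto simp: Rep_isoclass_inject)
qed

text \<open>The three residue classes modulo 3 provide pairwise disjoint ground sets for up to three
  factors.\<close>

lemma basis_eq_cls:
  fixes \<alpha> :: isoclass and i :: nat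
  assumes "i < 3"
  shows "\<exists>r :: nat rel. finposet r \<and> Field r \<subseteq> {n. n mod 3 = i} \<and> (basis \<alpha> :: isoclass \<Rightarrow>\<^sub>0 'k::field) = cls r"
proof -
  obtain r :: "nat rel" where r: "finposet r" "\<alpha> = isoclass_of r" using isoclass_of_surj by blast
  let ?f = "\<lambda>n. 3 * n + i"
  have inj: "inj_on ?f (Field r)" by (simp add: inj_on_def)
  have "(basis \<alpha> :: isoclass \<Rightarrow>\<^sub>0 'k) = cls (relabel ?f r)"
    unfolding cls_relabel[OF inj] by (simp add: r cls_def)
  moreover have "Field (relabel ?f r) \<subseteq> {n. n mod 3 = i}" using assms by auto
  ultimately show ?thesis using finposet_relabel[OF r(1) inj] by blast
qed

lemma bilin_eqI:
  fixes x y :: "isoclass \<Rightarrow>\<^sub>0 'k::field"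
  assumes "\<And>r s :: nat rel. finposet r \<Longrightarrow> finposet s \<Longrightarrow> Field r \<inter> Field s = {} \<Longrightarrow>
    bilin P D (cls r) (cls s) = bilin P' D' (cls s) (cls r)"
  shows "bilin P D x y = bilin P' D' y x"
proof -
  have "bilin P D (basis \<alpha>) (basis \<beta>) = bilin P' D' (basis \<beta>) (basis \<alpha>)" for \<alpha> \<beta>
  proof -
    obtain r :: "nat rel" where r: "finposet r" "Field r \<subseteq> {n. n mod 3 = 0}"
        "(basis \<alpha> :: isoclass \<Rightarrow>\<^sub>0 'k) = cls r"
      using basis_eq_cls[of 0 \<alpha>, where ?'k = 'k] by auto
    obtain s :: "nat rel" where s: "finposet s" "Field s \<subseteq> {n. n mod 3 = 1}"
        "(basis \<beta> :: isoclass \<Rightarrow>\<^sub>0 'k) = cls s"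
      using basis_eq_cls[of 1 \<beta>, where ?'k = 'k] by auto
    have "Field r \<inter> Field s = {}" using r(2) s(2) by force
    then show ?thesis unfolding r(3) s(3) using r(1) s(1) by (intro assms)
  qed
  then have "bilin P D x y = lin_ext (\<lambda>a. lin_ext (\<lambda>b. bilin P' D' (basis b) (basis a)) y) x"
    by (subst bilin_basis) (simp only:)
  also have "\<dots> = bilin P' D' y x"
    by (subst lin_ext_swap) (rule bilin_basis[symmetric])
  finally show ?thesis .
qed

text \<open>Four independent products are allowed, so that associativity and the permutative law,
  which mixes a triangle product with \<open>prod_m\<close>, are instances of one shape.\<close>

lemma bilin_bilin_eqI:
  fixes x y z :: "isoclass \<Rightarrow>\<^sub>0 'k::field"
  assumes "\<And>r s t :: nat rel. finposet r \<Longrightarrow> finposet s \<Longrightarrow> finposet t \<Longrightarrow>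
    Field r \<inter> Field s = {} \<Longrightarrow> Field r \<inter> Field t = {} \<Longrightarrow> Field s \<inter> Field t = {} \<Longrightarrow>
    bilin P D (bilin Q E (cls r) (cls s)) (cls t) = bilin P' D' (cls r) (bilin Q' E' (cls s) (cls t))"
  shows "bilin P D (bilin Q E x y) z = bilin P' D' x (bilin Q' E' y z)"
proof -
  have *: "bilin P D (bilin Q E (basis \<alpha>) (basis \<beta>)) (basis \<gamma>)
      = bilin P' D' (basis \<alpha>) (bilin Q' E' (basis \<beta>) (basis \<gamma>))" for \<alpha> \<beta> \<gamma>
  proof -
    obtain r :: "nat rel" where r: "finposet r" "Field r \<subseteq> {n. n mod 3 = 0}"
        "(basis \<alpha> :: isoclass \<Rightarrow>\<^sub>0 'k) = cls r"
      using basis_eq_cls[of 0 \<alpha>, where ?'k = 'k] by auto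
    obtain s :: "nat rel" where s: "finposet s" "Field s \<subseteq> {n. n mod 3 = 1}"
        "(basis \<beta> :: isoclass \<Rightarrow>\<^sub>0 'k) = cls s"
      using basis_eq_cls[of 1 \<beta>, where ?'k = 'k] by auto
    obtain t :: "nat rel" where t: "finposet t" "Field t \<subseteq> {n. n mod 3 = 2}"
        "(basis \<gamma> :: isoclass \<Rightarrow>\<^sub>0 'k) = cls t"
      using basis_eq_cls[of 2 \<gamma>, where ?'k = 'k] by auto
    have "Field r \<inter> Field s = {}" "Field r \<inter> Field t = {}" "Field s \<inter> Field t = {}"
      using r(2) s(2) t(2) by force+
    then show ?thesis unfolding r(3) s(3) t(3) using r(1) s(1) t(1) by (intro assms)
  qed
  \<comment> \<open>All three arguments are expanded over the basis. The variable of
    \<open>z\<close> comes out outermost and is then moved inside by two exchanges.\<close>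
  have "bilin P D (bilin Q E x y) z
      = bilin P D (lin_ext (\<lambda>a. lin_ext (\<lambda>b. bilin Q E (basis a) (basis b)) y) x) (lin_ext basis z)"
    unfolding lin_ext_basis_id bilin_basis[of Q E, symmetric] ..
  also have "\<dots> = lin_ext (\<lambda>c. lin_ext (\<lambda>a. lin_ext (\<lambda>b.
      bilin P D (bilin Q E (basis a) (basis b)) (basis c)) y) x) z"
    by (simp only: bilin_lin_ext_left bilin_lin_ext_right)
  also have "\<dots> = lin_ext (\<lambda>a. lin_ext (\<lambda>b. lin_ext (\<lambda>c.
      bilin P D (bilin Q E (basis a) (basis b)) (basis c)) z) y) x"
    by (subst lin_ext_swap, subst (2) lin_ext_swap) (rule refl)
  also have "\<dots> = lin_ext (\<lambda>a. lin_ext (\<lambda>b. lin_ext (\<lambda>c.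
      bilin P' D' (basis a) (bilin Q' E' (basis b) (basis c))) z) y) x"
    by (simp only: *)
  also have "\<dots> = bilin P' D' (lin_ext basis x) (lin_ext (\<lambda>b. lin_ext (\<lambda>c. bilin Q' E' (basis b) (basis c)) z) y)"
    by (subst bilin_lin_ext_left) (simp only: bilin_lin_ext_right)
  also have "\<dots> = bilin P' D' x (bilin Q' E' y z)"
    unfolding lin_ext_basis_id bilin_basis[of Q' E', symmetric] ..
  finally show ?thesis .
qed

section \<open>Laws of the products given by a single poset\<close>

lemma prod_m_commute: "prod_m x y = prod_m y x"
  unfolding prod_m_def
  by (rule bilin_eqI) (simp add: bilin_u poset_union_def Un_commute Int_commute)

lemma prod_m_assoc: "prod_m (prod_m x y) z = prod_m x (prod_m y z)"
  unfolding prod_m_def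
  by (rule bilin_bilin_eqI)
    (simp add: bilin_u finposet_union Field_union Int_Un_distrib Int_Un_distrib2, simp add: poset_union_def Un_assoc)

lemma prod_down_assoc: "prod_down (prod_down x y) z = prod_down x (prod_down y z)"
  unfolding prod_down_def
proof (rule bilin_bilin_eqI)
  fix r s t :: "nat rel"
  assume rst: "finposet r" "finposet s" "finposet t"
    "Field r \<inter> Field s = {}" "Field r \<inter> Field t = {}" "Field s \<inter> Field t = {}"
  have "poset_down (poset_down r s) t = r \<union> s \<union> Field r \<times> Field s \<union> t \<union> (Field r \<union> Field s) \<times> Field t"
    unfolding Field_down[OF rst(1,2,4), symmetric] by (simp add: poset_down_def)
  moreover have "poset_down r (poset_down s t)
      = r \<union> (s \<union> t \<union> Field s \<times> Field t) \<union> Field r \<times> (Field s \<union> Field t)"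
    unfolding Field_down[OF rst(2,3,6), symmetric] by (simp add: poset_down_def)
  ultimately have "poset_down (poset_down r s) t = poset_down r (poset_down s t)" by auto
  then show "bilin Bullet (basis c_poset) (bilin Bullet (basis c_poset) (cls r) (cls s)) (cls t)
      = bilin Bullet (basis c_poset) (cls r) (bilin Bullet (basis c_poset) (cls s) (cls t))"
    using rst by (simp add: bilin_Bullet_c finposet_down Field_down Int_Un_distrib Int_Un_distrib2)
qed

text \<open>On the right, \<open>r\<close> is attached to the maximal elements of the inner product,
  which all lie in \<open>t\<close>. Hence \<open>r\<close> and \<open>s\<close> stay incomparable,
  as in their union.\<close>

lemma prod_tri_nap: "prod_tri (prod_m x y) z = prod_tri x (prod_tri y z)"
  unfolding prod_tri_def prod_m_def
proof (rule bilin_bilin_eqI)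
  fix r s t :: "nat rel"
  assume rst: "finposet r" "finposet s" "finposet t"
    "Field r \<inter> Field s = {}" "Field r \<inter> Field t = {}" "Field s \<inter> Field t = {}"
  have "poset_tri (poset_union r s) t = r \<union> s \<union> t \<union> (Field r \<union> Field s) \<times> maximals t"
    unfolding Field_union[OF rst(1,2,4), symmetric] by (simp add: poset_tri_def poset_union_def)
  moreover have "poset_tri r (poset_tri s t) = r \<union> (s \<union> t \<union> Field s \<times> maximals t) \<union> Field r \<times> maximals t"
    unfolding poset_tri_def[of r] maximals_tri[OF rst(2,3,6)] by (simp add: poset_tri_def)
  ultimately have "poset_tri (poset_union r s) t = poset_tri r (poset_tri s t)" by auto
  then show "bilin BTriangle (basis c_poset) (bilin Circ (basis u_poset) (cls r) (cls s)) (cls t)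
      = bilin BTriangle (basis c_poset) (cls r) (bilin BTriangle (basis c_poset) (cls s) (cls t))"
    using rst by (simp add: bilin_u bilin_BTriangle_c finposet_union Field_union finposet_tri Field_tri
        Int_Un_distrib Int_Un_distrib2)
qed

lemma prod_tri_nap_swap: "prod_tri (prod_m x y) z = prod_tri y (prod_tri x z)"
  by (subst prod_m_commute) (rule prod_tri_nap)

lemma prod_tridown_nap: "prod_tridown (prod_m x y) z = prod_tridown x (prod_tridown y z)"
  unfolding prod_tridown_def prod_m_def
proof (rule bilin_bilin_eqI)
  fix r s t :: "nat rel"
  assume rst: "finposet r" "finposet s" "finposet t"
    "Field r \<inter> Field s = {}" "Field r \<inter> Field t = {}" "Field s \<inter> Field t = {}"
  have "poset_tridown (poset_union r s) t = r \<union> s \<union> t \<union> minimals t \<times> (Field r \<union> Field s)"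
    unfolding Field_union[OF rst(1,2,4), symmetric] by (simp add: poset_tridown_def poset_union_def)
  moreover have "poset_tridown r (poset_tridown s t)
      = r \<union> (s \<union> t \<union> minimals t \<times> Field s) \<union> minimals t \<times> Field r"
    unfolding poset_tridown_def[of r] minimals_tridown[OF rst(2,3,6)] by (simp add: poset_tridown_def)
  ultimately have "poset_tridown (poset_union r s) t = poset_tridown r (poset_tridown s t)" by auto
  then show "bilin BTriangledown (basis c'_poset) (bilin Circ (basis u_poset) (cls r) (cls s)) (cls t)
      = bilin BTriangledown (basis c'_poset) (cls r) (bilin BTriangledown (basis c'_poset) (cls s) (cls t))"
    using rst by (simp add: bilin_u bilin_BTriangledown_c' finposet_union Field_union finposet_tridown
        Field_tridown Int_Un_distrib Int_Un_distrib2)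
qed

lemma prod_tridown_nap_swap: "prod_tridown (prod_m x y) z = prod_tridown y (prod_tridown x z)"
  by (subst prod_m_commute) (rule prod_tridown_nap)

section \<open>Associativity of \<open>*\<close>\<close>

lemma Partial_order_Restr_Field:
  assumes "Partial_order t" "S \<subseteq> Field t"
  shows "Partial_order (Restr t S)" and "Field (Restr t S) = S"
proof -
  show F: "Field (Restr t S) = S"
  proof
    have "(x, x) \<in> Restr t S" if "x \<in> S" for x
      using that assms(2) Partial_order_refl[OF assms(1)] by auto
    then show "S \<subseteq> Field (Restr t S)" by (blast intro: FieldI1)
  qed (auto simp: Field_iff)
  show "Partial_order (Restr t S)"
    unfolding Partial_order_iff
    unfolding F
    using assms(2) Partial_order_refl[OF assms(1)] Partial_order_trans[OF assms(1)]
      Partial_order_antisym[OF assms(1)]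
    by auto
qed

definition star3_posets :: "'a rel \<Rightarrow> 'a rel \<Rightarrow> 'a rel \<Rightarrow> 'a rel set" where
  "star3_posets r s t = {u. Partial_order u \<and> Field u = Field r \<union> Field s \<union> Field t \<and>
     Restr u (Field r) = r \<and> Restr u (Field s) = s \<and> Restr u (Field t) = t \<and>
     u \<inter> Field s \<times> Field r = {} \<and> u \<inter> Field t \<times> Field r = {} \<and> u \<inter> Field t \<times> Field s = {}}"

lemma Restr_in_star_posets_iff:
  assumes "Partial_order u" "Field r \<union> Field s \<subseteq> Field u"
  shows "Restr u (Field r \<union> Field s) \<in> star_posets r s \<longleftrightarrow>
    Restr u (Field r) = r \<and> Restr u (Field s) = s \<and> u \<inter> Field s \<times> Field r = {}"
proof -
  have "Restr (Restr u (Field r \<union> Field s)) (Field r) = Restr u (Field r)"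
    "Restr (Restr u (Field r \<union> Field s)) (Field s) = Restr u (Field s)"
    "Restr u (Field r \<union> Field s) \<inter> Field s \<times> Field r = u \<inter> Field s \<times> Field r"
    by auto
  then show ?thesis
    unfolding star_posets_alt using Partial_order_Restr_Field[OF assms] by simp
qed

text \<open>The inner order \<open>v\<close> is forced to be the restriction of \<open>u\<close> to
  the union of the first two ground sets, so the existential over \<open>v\<close> becomes a
  condition on \<open>u\<close> alone.\<close>

lemma star_posets_left: "(\<Union>v\<in>star_posets r s. star_posets v t) = star3_posets r s t"
proof (rule set_eqI)
  fix u
  let ?M = "Field r \<union> Field s"
  have "Restr u ?M = v" if "v \<in> star_posets r s" "u \<in> star_posets v t" for v
    using that(2) Field_star_posets[OF that(1)] by (simp add: star_posets_alt)
  then have "u \<in> (\<Union>v\<in>star_posets r s. star_posets v t) \<longleftrightarrow>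
      Restr u ?M \<in> star_posets r s \<and> u \<in> star_posets (Restr u ?M) t"
    by blast
  also have "\<dots> \<longleftrightarrow> u \<in> star3_posets r s t"
  proof (cases "Partial_order u \<and> Field u = Field r \<union> Field s \<union> Field t")
    case True
    then have u: "Partial_order u" "?M \<subseteq> Field u" by auto
    show ?thesis
      using True unfolding Restr_in_star_posets_iff[OF u] star3_posets_def star_posets_alt[of u]
        Partial_order_Restr_Field(2)[OF u]
      by (auto simp: Un_assoc Sigma_Un_distrib1 Sigma_Un_distrib2 Int_Un_distrib)
  next
    case False
    have "Field (Restr u ?M) = ?M" if "Restr u ?M \<in> star_posets r s"
      using that by (rule Field_star_posets)
    with False show ?thesis by (auto simp: star_posets_alt[of u] star3_posets_def)
  qed
  finally show "u \<in> (\<Union>v\<in>star_posets r s. star_posets v t) \<longleftrightarrow> u \<in> star3_posets r s t" .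
qed

lemma star_posets_right: "(\<Union>v\<in>star_posets s t. star_posets r v) = star3_posets r s t"
proof (rule set_eqI)
  fix u
  let ?M = "Field s \<union> Field t"
  have "Restr u ?M = v" if "v \<in> star_posets s t" "u \<in> star_posets r v" for v
    using that(2) Field_star_posets[OF that(1)] by (simp add: star_posets_alt)
  then have "u \<in> (\<Union>v\<in>star_posets s t. star_posets r v) \<longleftrightarrow>
      Restr u ?M \<in> star_posets s t \<and> u \<in> star_posets r (Restr u ?M)"
    by blast
  also have "\<dots> \<longleftrightarrow> u \<in> star3_posets r s t"
  proof (cases "Partial_order u \<and> Field u = Field r \<union> Field s \<union> Field t")
    case True
    then have u: "Partial_order u" "?M \<subseteq> Field u" by auto
    show ?thesis
      using True unfolding Restr_in_star_posets_iff[OF u] star3_posets_def star_posets_alt[of u]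
        Partial_order_Restr_Field(2)[OF u]
      by (auto simp: Un_assoc Sigma_Un_distrib1 Sigma_Un_distrib2 Int_Un_distrib)
  next
    case False
    have "Field (Restr u ?M) = ?M" if "Restr u ?M \<in> star_posets s t"
      using that by (rule Field_star_posets)
    with False show ?thesis by (auto simp: star_posets_alt[of u] star3_posets_def)
  qed
  finally show "u \<in> (\<Union>v\<in>star_posets s t. star_posets r v) \<longleftrightarrow> u \<in> star3_posets r s t" .
qed

lemma prod_star_assoc: "prod_star (prod_star x y) z = prod_star x (prod_star y z)"
  unfolding prod_star_def
proof (rule bilin_bilin_eqI)
  fix r s t :: "nat rel"
  assume rst: "finposet r" "finposet s" "finposet t"
    "Field r \<inter> Field s = {}" "Field r \<inter> Field t = {}" "Field s \<inter> Field t = {}"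
  let ?star = "bilin Circ (basis u_poset + basis c_poset :: nat rel \<Rightarrow>\<^sub>0 'a)"
  have fin: "finite (star_posets p q)" if "finposet p" "finposet q" for p q :: "nat rel"
    using that by (intro finite_star_posets) (simp_all add: finposet_def)
  have v: "finposet v" "Field v \<inter> Field t = {}" if "v \<in> star_posets r s" for v
    using finposet_star[OF rst(1,2) that] Field_star_posets[OF that] rst(5,6) by auto
  have w: "finposet w" "Field r \<inter> Field w = {}" if "w \<in> star_posets s t" for w
    using finposet_star[OF rst(2,3) that] Field_star_posets[OF that] rst(4,5) by auto
  have "?star (?star (cls r) (cls s)) (cls t) = (\<Sum>v\<in>star_posets r s. \<Sum>u\<in>star_posets v t. cls u)"
    using rst v by (simp add: bilin_star bilin_sum_left)
  also have "\<dots> = (\<Sum>u\<in>(\<Union>v\<in>star_posets r s. star_posets v t). cls u)"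
    \<comment> \<open>All \<open>v\<close> have the same field and each is the restriction of
      \<open>u\<close> to it, so no \<open>u\<close> belongs to two different
      \<open>v\<close>.\<close>
    using fin rst v by (intro sum.UNION_disjoint[symmetric]) (auto simp: star_posets_alt)
  also have "\<dots> = (\<Sum>u\<in>(\<Union>w\<in>star_posets s t. star_posets r w). cls u)"
    by (simp only: star_posets_left star_posets_right)
  also have "\<dots> = (\<Sum>w\<in>star_posets s t. \<Sum>u\<in>star_posets r w. cls u)"
    using fin rst w by (intro sum.UNION_disjoint) (auto simp: star_posets_alt)
  also have "\<dots> = ?star (cls r) (?star (cls s) (cls t))"
    using rst w by (simp add: bilin_star bilin_sum_right)
  finally show "?star (?star (cls r) (cls s)) (cls t) = ?star (cls r) (?star (cls s) (cls t))" .
qed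

theorem theorem13:
  fixes A B :: "'a rel"
  assumes "finposet A" and "finposet B" and "Field A \<inter> Field B = {}"
  shows "
    (bilin Circ (basis u_poset) (cls A) (cls B) = (cls (poset_union A B) :: isoclass \<Rightarrow>\<^sub>0 'k::field) \<and>
     bilin Bullet (basis u_poset) (cls A) (cls B) = (cls (poset_union A B) :: isoclass \<Rightarrow>\<^sub>0 'k) \<and>
     bilin BTriangle (basis u_poset) (cls A) (cls B) = (cls (poset_union A B) :: isoclass \<Rightarrow>\<^sub>0 'k) \<and>
     bilin BTriangledown (basis u_poset) (cls A) (cls B) = (cls (poset_union A B) :: isoclass \<Rightarrow>\<^sub>0 'k) \<and>
     (\<forall>x y z :: isoclass \<Rightarrow>\<^sub>0 'k. prod_m (prod_m x y) z = prod_m x (prod_m y z)) \<and>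
     (\<forall>x y :: isoclass \<Rightarrow>\<^sub>0 'k. prod_m x y = prod_m y x)) \<and>
    (bilin Bullet (basis c_poset) (cls A) (cls B) = (cls (poset_down A B) :: isoclass \<Rightarrow>\<^sub>0 'k) \<and>
     (\<forall>x y z :: isoclass \<Rightarrow>\<^sub>0 'k. prod_down (prod_down x y) z = prod_down x (prod_down y z))) \<and>
    (bilin Circ (basis u_poset + basis c_poset) (cls A) (cls B)
       = (\<Sum>C\<in>star_posets A B. (cls C :: isoclass \<Rightarrow>\<^sub>0 'k)) \<and>
     (\<forall>x y z :: isoclass \<Rightarrow>\<^sub>0 'k. prod_star (prod_star x y) z = prod_star x (prod_star y z))) \<and>
    (bilin BTriangle (basis c_poset) (cls A) (cls B) = (cls (poset_tri A B) :: isoclass \<Rightarrow>\<^sub>0 'k) \<and>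
     (\<forall>x y z :: isoclass \<Rightarrow>\<^sub>0 'k.
        prod_tri x (prod_tri y z) = prod_tri (prod_m x y) z \<and>
        prod_tri (prod_m x y) z = prod_tri y (prod_tri x z))) \<and>
    (bilin BTriangledown (basis c'_poset) (cls A) (cls B) = (cls (poset_tridown A B) :: isoclass \<Rightarrow>\<^sub>0 'k) \<and>
     (\<forall>x y z :: isoclass \<Rightarrow>\<^sub>0 'k.
        prod_tridown x (prod_tridown y z) = prod_tridown (prod_m x y) z \<and>
        prod_tridown (prod_m x y) z = prod_tridown y (prod_tridown x z)))"
  by (intro conjI allI)
    (rule bilin_u[OF assms] bilin_Bullet_c[OF assms] bilin_star[OF assms] bilin_BTriangle_c[OF assms]
      bilin_BTriangledown_c'[OF assms] prod_m_assoc prod_m_commute prod_down_assoc prod_star_assoc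
      prod_tri_nap[symmetric] prod_tri_nap_swap prod_tridown_nap[symmetric] prod_tridown_nap_swap)+

end
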